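(* Let $n$, $k$, $r$ be positive integers with $n \geq k \geq r\geq 3$ and $r > t$, where $t=\lfloor (n-1)/2\rfloor$. If $H$ is an $n$-vertex $r$-uniform hypergraph with $\delta(H) \geq \lfloor \frac{r(k-1)}{n} \rfloor+1$, then $H$ contains a Berge cycle of length $k$ or longer.
   Context: A hypergraph is a family of (distinct) subsets, called edges, of a vertex set; it is $r$-uniform if every edge has exactly $r$ vertices. $\delta(H)$ denotes the minimum number of edges containing a vertex. A Berge cycle of length $\ell$ is a list $v_1, e_1, v_2, \ldots, v_\ell, e_\ell, v_1$ of $\ell$ distinct vertices and $\ell$ distinct edges with $\{v_i, v_{i+1}\} \subseteq e_i$ for all $i$ (indices modulo $\ell$). *)

theory Defs
  imports Main
begin

definition hypergraph :: "'a set \<Rightarrow> 'a set set \<Rightarrow> bool" where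
  "hypergraph V E \<longleftrightarrow> finite V \<and> E \<subseteq> Pow V"

definition uniform :: "nat \<Rightarrow> 'a set set \<Rightarrow> bool" where
  "uniform r E \<longleftrightarrow> (\<forall>e\<in>E. card e = r)"

definition degree :: "'a set set \<Rightarrow> 'a \<Rightarrow> nat" where
  "degree E v = card {e \<in> E. v \<in> e}"

text \<open>Only meaningful for finite nonempty \<open>V\<close>, as it uses \<open>Min\<close>.\<close>

definition min_degree :: "'a set \<Rightarrow> 'a set set \<Rightarrow> nat" where
  "min_degree V E = Min (degree E ` V)"

text \<open>The cycle \<open>v\<^sub>1, e\<^sub>1, \<dots>, v\<^sub>\<ell>, e\<^sub>\<ell>, v\<^sub>1\<close> is given by the list \<open>vs\<close> of its vertices
  and the list \<open>es\<close> of its edges, both indexed from \<open>0\<close>; its length is \<open>length es\<close>.\<close>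

definition berge_cycle :: "'a set \<Rightarrow> 'a set set \<Rightarrow> 'a list \<Rightarrow> 'a set list \<Rightarrow> bool" where
  "berge_cycle V E vs es \<longleftrightarrow>
     es \<noteq> [] \<and> length vs = length es \<and>
     distinct vs \<and> set vs \<subseteq> V \<and> distinct es \<and> set es \<subseteq> E \<and>
     (\<forall>i < length es. {vs ! i, vs ! (Suc i mod length es)} \<subseteq> es ! i)"

end

theory Submission
  imports Defs
begin

text \<open>
  Work in the bipartite incidence graph. Here \<open>n \<le> 2 * r\<close>, and double counting turns the
  degree condition into \<open>k \<le> card E\<close> and \<open>k \<le> 2 * d + 2\<close> for \<open>d = r * (k - 1) div n\<close>.
  Suppose that there is no cycle of length \<open>k\<close> or more, and let \<open>p\<close> be the largest number of
  vertices on a path whose two ends are hyperedges.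

  No cycle is longer than \<open>p\<close>. Conversely, the end edges of a longest such path have at least half
  of all vertices each, so a crossing argument yields a cycle \<open>C\<close> of length exactly \<open>p\<close> together
  with an edge \<open>g\<close> outside \<open>C\<close> that meets \<open>C\<close>. If \<open>g\<close> has at least two vertices outside \<open>C\<close>, then
  two of them have so few incidences with \<open>C\<close> that their degrees are too small. Otherwise there is a
  path with \<open>p + 1\<close> vertices and \<open>p + 1\<close> edges that starts with \<open>g\<close>, ends with a vertex \<open>y\<close>, and
  contains all of \<open>g\<close>. All edges at \<open>y\<close> lie on it by the choice of \<open>p\<close>, and a crossing argument gives
  \<open>r + d + 1 \<le> p + 1 \<le> k\<close>. This is possible only for \<open>k = n = 2 * r = p + 1\<close>, where equality
  determines the neighbours of both ends of every spanning path of this kind; rotating the path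
  then produces an edge with \<open>r + 1\<close> vertices.
\<close>

section \<open>Paths and cycles in the incidence graph\<close>

text \<open>Tagging vertices with \<open>Inl\<close> and hyperedges with \<open>Inr\<close> turns a
  Berge path or cycle into one alternating list. Reversing, cutting and rotating become list
  operations, and a single \<open>distinct\<close> covers both sides.\<close>

fun incident :: "'a + 'a set \<Rightarrow> 'a + 'a set \<Rightarrow> bool" where
  "incident (Inl v) (Inr e) \<longleftrightarrow> v \<in> e"
| "incident (Inr e) (Inl v) \<longleftrightarrow> v \<in> e"
| "incident _ _ \<longleftrightarrow> False"

lemma incident_sym: "incident a b \<longleftrightarrow> incident b a"
  by (cases a; cases b) auto

lemma incident_isl: "incident a b \<Longrightarrow> isl b \<longleftrightarrow> \<not> isl a"
  by (cases a; cases b) auto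

definition bpath :: "'a set \<Rightarrow> 'a set set \<Rightarrow> ('a + 'a set) list \<Rightarrow> bool" where
  "bpath V E xs \<longleftrightarrow> set xs \<subseteq> Inl ` V \<union> Inr ` E \<and> distinct xs \<and> successively incident xs"

text \<open>One vertex together with one edge through it already counts as a cycle, in agreement
  with \<open>berge_cycle\<close> at length 1.\<close>

definition bcycle :: "'a set \<Rightarrow> 'a set set \<Rightarrow> ('a + 'a set) list \<Rightarrow> bool" where
  "bcycle V E xs \<longleftrightarrow> bpath V E xs \<and> xs \<noteq> [] \<and> incident (last xs) (hd xs)"

lemma bpath_append:
  "bpath V E (xs @ ys) \<longleftrightarrow> bpath V E xs \<and> bpath V E ys \<and> set xs \<inter> set ys = {} \<and>
     (xs = [] \<or> ys = [] \<or> incident (last xs) (hd ys))"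
  by (auto simp: bpath_def successively_append_iff)

lemma bpath_Cons:
  "bpath V E (x # xs) \<longleftrightarrow> x \<in> Inl ` V \<union> Inr ` E \<and> x \<notin> set xs \<and> bpath V E xs \<and>
     (xs = [] \<or> incident x (hd xs))"
  by (auto simp: bpath_def successively_Cons)

lemma bpath_Nil: "bpath V E []"
  by (simp add: bpath_def)

lemma bpath_rev: "bpath V E (rev xs) \<longleftrightarrow> bpath V E xs"
proof -
  have "successively (\<lambda>x y. incident y x) xs = successively incident xs"
    by (intro successively_cong) (auto simp: incident_sym)
  then show ?thesis by (simp add: bpath_def)
qed

lemma bpath_take: "bpath V E xs \<Longrightarrow> bpath V E (take i xs)"
  using bpath_append[of V E "take i xs" "drop i xs"] by simp

lemma bpath_drop: "bpath V E xs \<Longrightarrow> bpath V E (drop i xs)"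
  using bpath_append[of V E "take i xs" "drop i xs"] by simp

lemma bpath_nth_incident: "bpath V E xs \<Longrightarrow> Suc i < length xs \<Longrightarrow> incident (xs ! i) (xs ! Suc i)"
  by (auto simp: bpath_def intro: successively_nth)

lemma bpath_isl_nth:
  "bpath V E xs \<Longrightarrow> i < length xs \<Longrightarrow> isl (xs ! i) \<longleftrightarrow> (isl (hd xs) \<longleftrightarrow> even i)"
proof (induction i)
  case 0
  then show ?case by (simp add: hd_conv_nth)
next
  case (Suc i)
  then show ?case
    using incident_isl[OF bpath_nth_incident[of V E xs i]] by auto
qed

lemma bpath_Inl_index:
  assumes "bpath V E xs" "\<not> isl (hd xs)" "Inl v \<in> set xs"
  shows "\<exists>i. 2 * i + 1 < length xs \<and> xs ! (2 * i + 1) = Inl v"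
proof -
  obtain j where j: "j < length xs" "xs ! j = Inl v"
    using assms(3) by (auto simp: in_set_conv_nth)
  then have "odd j"
    using bpath_isl_nth[OF assms(1), of j] assms(2) by auto
  then show ?thesis
    using j by (auto elim!: oddE)
qed

lemma bpath_Inr_index:
  assumes "bpath V E xs" "\<not> isl (hd xs)" "Inr e \<in> set xs"
  shows "\<exists>i. 2 * i < length xs \<and> xs ! (2 * i) = Inr e"
proof -
  obtain j where j: "j < length xs" "xs ! j = Inr e"
    using assms(3) by (auto simp: in_set_conv_nth)
  then have "even j"
    using bpath_isl_nth[OF assms(1), of j] assms(2) by auto
  then show ?thesis
    using j by (auto elim!: evenE)
qed

lemma bpath_nth_Inl:
  assumes "bpath V E xs" "\<not> isl (hd xs)" "2 * i + 1 < length xs"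
  shows "\<exists>v\<in>V. xs ! (2 * i + 1) = Inl v"
proof -
  have "isl (xs ! (2 * i + 1))"
    using bpath_isl_nth[OF assms(1,3)] assms(2) by simp
  moreover have "xs ! (2 * i + 1) \<in> Inl ` V \<union> Inr ` E"
    using assms(1,3) nth_mem unfolding bpath_def by blast
  ultimately show ?thesis by auto
qed

lemma bpath_nth_Inr:
  assumes "bpath V E xs" "\<not> isl (hd xs)" "2 * i < length xs"
  shows "\<exists>e\<in>E. xs ! (2 * i) = Inr e"
proof -
  have "\<not> isl (xs ! (2 * i))"
    using bpath_isl_nth[OF assms(1,3)] assms(2) by simp
  moreover have "xs ! (2 * i) \<in> Inl ` V \<union> Inr ` E"
    using assms(1,3) nth_mem unfolding bpath_def by blast
  ultimately show ?thesis by auto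
qed

section \<open>Cycles: rotation, crossing, and translation to Berge cycles\<close>

lemma bcycle_even_length:
  assumes "bcycle V E ys"
  shows "even (length ys)"
proof -
  have *: "bpath V E ys" "ys \<noteq> []" "incident (last ys) (hd ys)"
    using assms by (auto simp: bcycle_def)
  show ?thesis
    using bpath_isl_nth[OF *(1), of "length ys - 1"] incident_isl[OF *(3)] *(2)
    by (cases ys rule: rev_cases) (auto simp: last_conv_nth)
qed

lemma bcycle_rotate: "bcycle V E ys \<Longrightarrow> bcycle V E (rotate m ys)"
proof (induction m)
  case (Suc m)
  then have *: "bcycle V E (rotate m ys)" by simp
  then obtain x zs where eq: "rotate m ys = x # zs"
    by (cases "rotate m ys") (auto simp: bcycle_def)
  show ?case
  proof (cases "zs = []")
    case True
    then show ?thesis using * eq by simp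
  next
    case False
    then show ?thesis
      using * eq by (auto simp: bcycle_def bpath_append bpath_Cons bpath_Nil)
  qed
qed simp

lemma bcycle_rotate_to:
  assumes "bcycle V E ys" "x \<in> set ys"
  shows "\<exists>zs. bcycle V E (x # zs) \<and> set (x # zs) = set ys \<and> length (x # zs) = length ys"
proof -
  obtain j where j: "j < length ys" "ys ! j = x"
    using assms(2) by (auto simp: in_set_conv_nth)
  then have "hd (rotate j ys) = x"
    by (simp add: hd_rotate_conv_nth flip: length_greater_0_conv)
  moreover have "rotate j ys \<noteq> []"
    using j by auto
  ultimately obtain zs where "rotate j ys = x # zs"
    by (cases "rotate j ys") auto
  then show ?thesis
    using bcycle_rotate[OF assms(1), of j] by (metis length_rotate set_rotate)
qed

text \<open>Walk from position \<open>i\<close> back to the head, jump to position \<open>j\<close>,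
  go on to the last entry and close up at position \<open>i\<close>. Only the entries strictly
  between \<open>i\<close> and \<open>j\<close> are lost, which fixes the cycle length in each later
  use.\<close>

lemma bpath_crossing_bcycle:
  assumes "bpath V E xs" "i < j" "j < length xs"
    and "incident (hd xs) (xs ! j)" "incident (last xs) (xs ! i)"
  shows "bcycle V E (rev (take (Suc i) xs) @ drop j xs)"
proof -
  have 1: "bpath V E (rev (take (Suc i) xs))" "bpath V E (drop j xs)"
    using assms(1) by (simp_all add: bpath_rev bpath_take bpath_drop)
  have "set (take (Suc i) xs) \<inter> set (drop j xs) = {}"
    using assms(1,2) by (intro set_take_disj_set_drop_if_distinct) (auto simp: bpath_def)
  moreover have "last (take (Suc i) xs) = xs ! i"
    using assms(2,3) by (simp add: take_Suc_conv_app_nth)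
  moreover have "hd (take (Suc i) xs) = hd xs" "last (drop j xs) = last xs"
    "hd (drop j xs) = xs ! j" "xs \<noteq> []"
    using assms(2,3) by (auto simp: hd_drop_conv_nth)
  ultimately show ?thesis
    using 1 assms
    by (simp add: bcycle_def bpath_append hd_rev last_rev hd_append last_append)
qed

lemma bcycle_edge_first:
  assumes "bcycle V E ys"
  shows "\<exists>zs. bcycle V E zs \<and> \<not> isl (hd zs) \<and> set zs = set ys \<and> length zs = length ys"
proof -
  have y: "bpath V E ys" "ys \<noteq> []" "incident (last ys) (hd ys)"
    using assms by (auto simp: bcycle_def)
  then have "\<not> isl (hd ys) \<or> \<not> isl (last ys)"
    using incident_isl by blast
  then obtain x where "x \<in> set ys" "\<not> isl x"
    using y(2) hd_in_set last_in_set by blast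
  then show ?thesis
    using bcycle_rotate_to[OF assms] by (metis list.sel(1))
qed

lemma bpath_card_edges:
  assumes "bpath V E xs" "\<not> isl (hd xs)" "length xs = 2 * l"
  shows "card {e. Inr e \<in> set xs} \<le> l"
proof -
  have "{e. Inr e \<in> set xs} \<subseteq> (\<lambda>i. projr (xs ! (2 * i))) ` {..<l}"
  proof
    fix e assume "e \<in> {e. Inr e \<in> set xs}"
    then obtain i where "2 * i < length xs" "xs ! (2 * i) = Inr e"
      using bpath_Inr_index[OF assms(1,2)] by auto
    then show "e \<in> (\<lambda>i. projr (xs ! (2 * i))) ` {..<l}"
      using assms(3) by (intro image_eqI[of _ _ i]) auto
  qed
  then show ?thesis
    using surj_card_le[of "{..<l}"] by simp
qed

lemma bcycle_berge_cycle:
  assumes "bcycle V E ys"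
  shows "\<exists>vs es. berge_cycle V E vs es \<and> length es = length ys div 2"
proof -
  obtain zs where z: "bcycle V E zs" "length zs = length ys" and r: "\<not> isl (hd zs)"
    using bcycle_edge_first[OF assms] by blast
  have zp: "bpath V E zs" "zs \<noteq> []" "incident (last zs) (hd zs)"
    using z(1) by (auto simp: bcycle_def)
  obtain l where l: "length zs = 2 * l"
    using bcycle_even_length[OF z(1)] by auto
  then have l0: "l > 0" using zp(2) by (cases l) auto
  define es where "es = map (\<lambda>i. projr (zs ! (2 * i))) [0..<l]"
  \<comment> \<open>The vertex \<open>vs ! i\<close> must lie cyclically just before
    \<open>es ! i\<close>, at position \<open>2 * i - 1\<close>. Adding \<open>2 * l\<close> first
    prevents truncated subtraction at \<open>i = 0\<close>.\<close>
  define vs where "vs = map (\<lambda>i. projl (zs ! ((2 * i + 2 * l - 1) mod (2 * l)))) [0..<l]"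
  have e: "projr (zs ! (2 * i)) \<in> E \<and> zs ! (2 * i) = Inr (projr (zs ! (2 * i)))" if "i < l" for i
    using bpath_nth_Inr[OF zp(1) r, of i] that l by auto
  have v: "projl (zs ! (2 * i + 1)) \<in> V \<and> zs ! (2 * i + 1) = Inl (projl (zs ! (2 * i + 1)))" if "i < l" for i
    using bpath_nth_Inl[OF zp(1) r, of i] that l by auto
  have idx: "(2 * i + 2 * l - 1) mod (2 * l) = (if i = 0 then 2 * (l - 1) + 1 else 2 * (i - 1) + 1)" if "i < l" for i
  proof (cases i)
    case (Suc j)
    have "2 * i + 2 * l - 1 = (2 * j + 1) + 2 * l" using Suc by simp
    moreover have "2 * j + 1 < 2 * l" using Suc that by simp
    ultimately show ?thesis using Suc by (simp only: mod_add_self2) simp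
  qed (use l0 in auto)
  have vi: "\<exists>j<l. (2 * i + 2 * l - 1) mod (2 * l) = 2 * j + 1" if "i < l" for i
    using idx[OF that] that by (cases "i = 0") (auto intro: exI[of _ "l - 1"] exI[of _ "i - 1"])
  have dz: "distinct zs" using zp(1) by (simp add: bpath_def)
  have "distinct es"
  proof -
    have "inj_on (\<lambda>i. projr (zs ! (2 * i))) {0..<l}"
    proof (rule inj_onI)
      fix i j assume ij: "i \<in> {0..<l}" "j \<in> {0..<l}" "projr (zs ! (2 * i)) = projr (zs ! (2 * j))"
      then have "zs ! (2 * i) = zs ! (2 * j)" using e[of i] e[of j] by auto
      then show "i = j" using nth_eq_iff_index_eq[OF dz, of "2 * i" "2 * j"] ij l by auto
    qed
    then show ?thesis by (simp add: es_def distinct_map)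
  qed
  moreover have "distinct vs"
  proof -
    have "inj_on (\<lambda>i. projl (zs ! ((2 * i + 2 * l - 1) mod (2 * l)))) {0..<l}"
    proof (rule inj_onI)
      fix i j assume ij: "i \<in> {0..<l}" "j \<in> {0..<l}"
        "projl (zs ! ((2 * i + 2 * l - 1) mod (2 * l))) = projl (zs ! ((2 * j + 2 * l - 1) mod (2 * l)))"
      obtain i' where i': "i' < l" "(2 * i + 2 * l - 1) mod (2 * l) = 2 * i' + 1"
        using vi[of i] ij by auto
      obtain j' where j': "j' < l" "(2 * j + 2 * l - 1) mod (2 * l) = 2 * j' + 1"
        using vi[of j] ij by auto
      have "zs ! (2 * i' + 1) = zs ! (2 * j' + 1)"
        using v[of i'] v[of j'] i' j' ij(3) by metis
      then have "i' = j'"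
        using nth_eq_iff_index_eq[OF dz, of "2 * i' + 1" "2 * j' + 1"] i' j' l by auto
      then have "(2 * i + 2 * l - 1) mod (2 * l) = (2 * j + 2 * l - 1) mod (2 * l)"
        using i' j' by simp
      then show "i = j"
        using idx[of i] idx[of j] ij by (auto split: if_splits)
    qed
    then show ?thesis by (simp add: vs_def distinct_map)
  qed
  moreover have "set es \<subseteq> E"
    using e by (auto simp: es_def)
  moreover have "set vs \<subseteq> V"
    using v vi by (fastforce simp: vs_def)
  moreover have "{vs ! i, vs ! (Suc i mod l)} \<subseteq> es ! i" if i: "i < l" for i
  proof -
    have 1: "vs ! i \<in> es ! i"
    proof (cases i)
      case 0
      have "zs ! (2 * (l - 1) + 1) = last zs"
        using l l0 zp(2) by (cases l) (simp_all add: last_conv_nth)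
      moreover have "hd zs = zs ! (2 * 0)" using zp(2) by (simp add: hd_conv_nth)
      ultimately show ?thesis
        using zp(3) idx[OF i] v[of "l - 1"] e[of 0] l0 0
        by (simp add: vs_def es_def) (metis incident.simps(1) mult_0_right)
    next
      case (Suc j)
      have "incident (zs ! (2 * j + 1)) (zs ! (2 * i))"
        using bpath_nth_incident[OF zp(1), of "2 * j + 1"] Suc i l by simp
      moreover have "vs ! i = projl (zs ! (2 * j + 1))"
        using i idx[OF i] Suc by (simp add: vs_def)
      ultimately show ?thesis
        using v[of j] e[of i] i Suc
        by (simp add: es_def) (metis incident.simps(1))
    qed
    have "incident (zs ! (2 * i)) (zs ! (2 * i + 1))"
      using bpath_nth_incident[OF zp(1), of "2 * i"] i l by simp
    moreover have "vs ! (Suc i mod l) = projl (zs ! (2 * i + 1))"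
    proof (cases "Suc i = l")
      case True
      then show ?thesis using idx[of 0] l0 by (auto simp: vs_def)
    next
      case False
      then have "Suc i < l" using i by simp
      then show ?thesis using idx[of "Suc i"] by (simp add: vs_def)
    qed
    ultimately have "vs ! (Suc i mod l) \<in> es ! i"
      using v[OF i] e[OF i] i
      by (simp add: es_def) (metis incident.simps(2))
    with 1 show ?thesis by simp
  qed
  ultimately have "berge_cycle V E vs es"
    using l0 by (simp add: berge_cycle_def es_def vs_def)
  moreover have "length es = length ys div 2"
    using z(2) l by (simp add: es_def)
  ultimately show ?thesis by blast
qed

section \<open>A counting bound for crossing arguments\<close>

text \<open>Intended for vertices \<open>v 0, ..., v (p - 1)\<close> of a path, with
  \<open>S\<close> built from possible first edges and \<open>T\<close> from possible last edges.
  The two \<open>of_bool\<close> terms are gains beyond the usual bound, needed because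
  \<open>card S + card T <= card V + 1\<close> alone is not contradictory for two edges.\<close>

lemma shifted_card_bound:
  fixes v :: "nat \<Rightarrow> 'a"
  assumes "finite V" "inj_on v {..<p}" "v ` {..<p} \<subseteq> V" "p \<ge> 3" "S \<subseteq> V" "T \<subseteq> V"
    and cross: "\<And>i. Suc i < p \<Longrightarrow> v (Suc i) \<in> S \<Longrightarrow> v i \<notin> T"
    and ends: "v (p - 1) \<notin> S" "v 0 \<notin> T" and off: "S \<inter> T \<subseteq> v ` {..<p}"
  shows "card S + card T + of_bool (v 1 \<notin> S) + of_bool (v (p - 2) \<notin> T) \<le> card V + 1"
proof -
  \<comment> \<open>\<open>\<sigma>\<close> shifts \<open>v 0, v 1, \<dots>\<close> by one place, the last one going to \<open>None\<close>; then \<open>S\<close> and the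
    image of \<open>T\<close> are disjoint.\<close>
  define w where "w x = inv_into {..<p} v x" for x
  have w: "w (v i) = i" if "i < p" for i
    using that assms(2) by (simp add: w_def)
  define \<sigma> where "\<sigma> x = (if x \<in> v ` {..<p} then if Suc (w x) = p then None else Some (v (Suc (w x)))
    else Some x)" for x
  have sv: "\<sigma> (v i) = (if Suc i = p then None else Some (v (Suc i)))" if "i < p" for i
    using that w by (simp add: \<sigma>_def)
  have so: "\<sigma> x = Some x" if "x \<notin> v ` {..<p}" for x
    using that by (simp add: \<sigma>_def)
  have vv: "v i = v j \<longleftrightarrow> i = j" if "i < p" "j < p" for i j
    using that assms(2) by (auto simp: inj_on_def)
  have inj: "x = y" if "\<sigma> x = \<sigma> y" for x y
  proof (cases "x \<in> v ` {..<p}")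
    case True
    then obtain i where i: "i < p" "x = v i" by blast
    show ?thesis
    proof (cases "y \<in> v ` {..<p}")
      case True
      then obtain j where j: "j < p" "y = v j" by blast
      then show ?thesis
        using that i sv[of i] sv[of j] vv[of "Suc i" "Suc j"] by (auto split: if_splits)
    next
      case False
      then show ?thesis
        using that i sv[of i] so[of y] by (auto split: if_splits)
    qed
  next
    case out: False
    show ?thesis
    proof (cases "y \<in> v ` {..<p}")
      case True
      then obtain j where j: "j < p" "y = v j" by blast
      then show ?thesis
        using that out so[of x] sv[of j] by (auto split: if_splits)
    next
      case False
      then show ?thesis
        using that so[OF out] so[of y] by simp
    qed
  qed
  \<comment> \<open>\<open>X\<close> collects values hit by neither set: \<open>Some (v 1)\<close>
    could only come from \<open>v 0\<close>, which is not in \<open>T\<close>, and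
    \<open>v (p - 1)\<close> is not in \<open>S\<close>. The two values differ because
    \<open>p >= 3\<close>.\<close>
  define X where "X = (if v 1 \<notin> S then {Some (v 1)} else {}) \<union>
    (if v (p - 2) \<notin> T then {Some (v (p - 1))} else {})"
  have s1: "\<sigma> (v 0) = Some (v 1)" "\<sigma> (v (p - 2)) = Some (v (p - 1))"
  proof -
    obtain q where q: "p = Suc (Suc q)" "q > 0" using assms(4) by (cases p; cases "p - 1") auto
    then show "\<sigma> (v 0) = Some (v 1)" "\<sigma> (v (p - 2)) = Some (v (p - 1))"
      using sv[of 0] sv[of q] by simp_all
  qed
  have cX: "card X = of_bool (v 1 \<notin> S) + of_bool (v (p - 2) \<notin> T)"
  proof -
    have "1 < p" "p - 1 < p" "1 \<noteq> p - 1" using assms(4) by auto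
    then have "v 1 \<noteq> v (p - 1)" using vv[of 1 "p - 1"] by blast
    then show ?thesis by (simp add: X_def)
  qed
  have fin: "finite S" "finite T" "finite X"
    using assms(1,5,6) finite_subset by (auto simp: X_def)
  have AX: "Some ` S \<inter> X = {}"
    using ends by (auto simp: X_def)
  have BX: "\<sigma> ` T \<inter> X = {}"
  proof -
    have "Some (v 1) \<notin> \<sigma> ` T"
    proof
      assume "Some (v 1) \<in> \<sigma> ` T"
      then obtain x where "x \<in> T" "\<sigma> x = \<sigma> (v 0)" using s1(1) by auto
      then show False using inj[of x "v 0"] ends(2) by simp
    qed
    moreover have "Some (v (p - 1)) \<notin> \<sigma> ` T" if "v (p - 2) \<notin> T"
    proof
      assume "Some (v (p - 1)) \<in> \<sigma> ` T"
      then obtain x where "x \<in> T" "\<sigma> x = \<sigma> (v (p - 2))" using s1(2) by auto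
      then show False using inj[of x "v (p - 2)"] that by simp
    qed
    ultimately show ?thesis by (simp add: X_def)
  qed
  have AB: "Some ` S \<inter> \<sigma> ` T = {}"
  proof (rule ccontr)
    assume "Some ` S \<inter> \<sigma> ` T \<noteq> {}"
    then obtain z where z: "z \<in> Some ` S" "z \<in> \<sigma> ` T" by blast
    then obtain s x where "s \<in> S" "z = Some s" "x \<in> T" "z = \<sigma> x" by blast
    then have sx: "s \<in> S" "x \<in> T" "\<sigma> x = Some s" by simp_all
    show False
    proof (cases "x \<in> v ` {..<p}")
      case True
      then obtain i where i: "i < p" "x = v i" by blast
      then have "Suc i < p" "s = v (Suc i)"
        using sx sv[of i] by (auto split: if_splits)
      then show False using cross[of i] sx i by simp
    next
      case False
      then have "s = x" using sx so by simp
      then show False using sx off False by blast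
    qed
  qed
  have "card (Some ` S \<union> \<sigma> ` T \<union> X) = card (Some ` S) + card (\<sigma> ` T) + card X"
    using AX BX AB fin by (simp add: card_Un_disjoint Int_Un_distrib2)
  also have "card (\<sigma> ` T) = card T"
    using inj by (intro card_image) (auto simp: inj_on_def)
  also have "card (Some ` S) = card S"
    by (simp add: card_image)
  finally have "card S + card T + card X = card (Some ` S \<union> \<sigma> ` T \<union> X)" by simp
  also have "\<dots> \<le> card (insert None (Some ` V))"
  proof (intro card_mono)
    have "\<sigma> x \<in> insert None (Some ` V)" if "x \<in> T" for x
    proof (cases "x \<in> v ` {..<p}")
      case True
      then obtain i where i: "i < p" "x = v i" by blast
      then have "v (Suc i) \<in> V" if "Suc i \<noteq> p" using that assms(3) by auto
      then show ?thesis using i sv[of i] by simp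
    next
      case False
      then show ?thesis using so that assms(6) by auto
    qed
    moreover have "X \<subseteq> Some ` V"
    proof -
      have "v 1 \<in> V" "v (p - 1) \<in> V" using assms(3,4) by auto
      then show ?thesis by (simp add: X_def)
    qed
    ultimately show "Some ` S \<union> \<sigma> ` T \<union> X \<subseteq> insert None (Some ` V)"
      using assms(5) by auto
  qed (use assms(1) in auto)
  also have "\<dots> = card V + 1"
    using assms(1) by (simp add: card_image)
  finally show ?thesis using cX by simp
qed

section \<open>Hypergraphs without long cycles\<close>

text \<open>The setting of a counterexample: \<open>d\<close> stands for
  \<open>r * (k - 1) div n\<close> with \<open>n = card V\<close>, and enters only through
  \<open>degree_gt\<close> and \<open>k_le_d\<close>.\<close>

locale no_long_bcycle =
  fixes V :: "'a set" and E :: "'a set set" and r k d :: nat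
  assumes finite_V: "finite V"
    and E_Pow: "E \<subseteq> Pow V"
    and card_edge: "e \<in> E \<Longrightarrow> card e = r"
    and V_le: "card V \<le> 2 * r"
    and r_ge_3: "3 \<le> r"
    and r_le_k: "r \<le> k"
    and k_le_V: "k \<le> card V"
    and degree_gt: "v \<in> V \<Longrightarrow> d < card {e \<in> E. v \<in> e}"
    and k_le_d: "k \<le> 2 * d + 2"
    and k_le_E: "k \<le> card E"
    and no_bcycle: "bcycle V E ys \<Longrightarrow> length ys < 2 * k"
begin

lemma finite_E: "finite E"
  using finite_V E_Pow finite_subset by blast

lemma finite_edge: "e \<in> E \<Longrightarrow> finite e"
  using finite_V E_Pow finite_subset by blast

lemma edge_subset: "e \<in> E \<Longrightarrow> e \<subseteq> V"
  using E_Pow by blast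

lemma d_pos: "d \<ge> 1"
  using k_le_d r_le_k r_ge_3 by linarith

lemma other_edge:
  assumes "v \<in> V"
  shows "\<exists>h\<in>E. v \<in> h \<and> h \<noteq> e"
proof (rule ccontr)
  assume "\<not> ?thesis"
  then have "{h \<in> E. v \<in> h} \<subseteq> {e}" by blast
  then have "card {h \<in> E. v \<in> h} \<le> 1"
    using card_mono[of "{e}"] by simp
  then show False using degree_gt[OF assms] d_pos by simp
qed

lemma card_Un_edges:
  assumes "e \<in> E" "f \<in> E" "e \<noteq> f"
  shows "r < card (e \<union> f)"
proof (rule ccontr)
  assume "\<not> ?thesis"
  then have "card (e \<union> f) \<le> card e" "card (e \<union> f) \<le> card f"
    using card_edge assms by auto
  moreover have "finite (e \<union> f)"
    using assms finite_edge by simp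
  ultimately have "e = e \<union> f" "f = e \<union> f"
    using card_seteq[of "e \<union> f" e] card_seteq[of "e \<union> f" f] by blast+
  then show False using assms(3) by simp
qed

text \<open>A cycle has as many edges as vertices, hence fewer than \<open>k\<close>, while
  \<open>k <= card E\<close>.\<close>

lemma edge_outside:
  assumes "bcycle V E ys"
  shows "\<exists>g\<in>E. Inr g \<notin> set ys"
proof (rule ccontr)
  assume "\<not> ?thesis"
  then have sub: "E \<subseteq> {e. Inr e \<in> set ys}" by blast
  obtain zs where zs: "bcycle V E zs" "\<not> isl (hd zs)" "set zs = set ys" "length zs = length ys"
    using bcycle_edge_first[OF assms] by blast
  obtain l where l: "length ys = 2 * l"
    using bcycle_even_length[OF assms] by auto
  have "finite {e. Inr e \<in> set ys}"
    using finite_vimageI[of "set ys" Inr] by (simp add: vimage_def)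
  then have "card E \<le> card {e. Inr e \<in> set ys}"
    using sub by (intro card_mono)
  also have "\<dots> \<le> l"
    using bpath_card_edges[of V E zs l] zs l by (simp add: bcycle_def)
  finally show False
    using no_bcycle[OF assms] k_le_E l by simp
qed

end

text \<open>A list of odd length that starts with an edge also ends with one, so \<open>p\<close>
  counts the vertices of a longest path with edges at both ends.\<close>

locale longest_edge_path = no_long_bcycle +
  fixes p :: nat
  assumes longest_ex: "\<exists>xs. bpath V E xs \<and> \<not> isl (hd xs) \<and> length xs = 2 * p + 1"
    and longest: "bpath V E xs \<Longrightarrow> \<not> isl (hd xs) \<Longrightarrow> length xs = 2 * q + 1 \<Longrightarrow> q \<le> p"
begin

lemma p_pos: "p \<ge> 1"
proof -
  have "V \<noteq> {}"
    using k_le_V r_le_k r_ge_3 by auto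
  then obtain v where v: "v \<in> V" by blast
  obtain e where e: "e \<in> E" "v \<in> e"
    using other_edge[OF v] by blast
  obtain h where h: "h \<in> E" "v \<in> h" "h \<noteq> e"
    using other_edge[OF v] by blast
  have "bpath V E [Inr h, Inl v, Inr e]"
    using v e h by (auto simp: bpath_Cons bpath_Nil)
  from longest[OF this, of 1] show ?thesis by simp
qed

text \<open>Take a longer cycle and an edge \<open>g\<close> outside it. If \<open>g\<close> meets
  the cycle in a vertex, or shares a vertex off the cycle with a cycle edge, then opening the cycle
  there and prepending \<open>g\<close> gives too long a path. So \<open>g\<close> is disjoint from
  two distinct cycle edges, whose union has more than \<open>r\<close> vertices, against
  \<open>card V <= 2 * r\<close>.\<close>

lemma bcycle_length_le:
  assumes "bcycle V E ys"
  shows "length ys \<le> 2 * p"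
proof (rule ccontr)
  assume long: "\<not> ?thesis"
  obtain l where l: "length ys = 2 * l"
    using bcycle_even_length[OF assms] by auto
  have pl: "l \<ge> p + 1" using long l by simp
  have yp: "bpath V E ys" using assms by (simp add: bcycle_def)
  obtain g where g: "g \<in> E" "Inr g \<notin> set ys"
    using edge_outside[OF assms] by blast
  have avoid: "Inl v \<notin> set ys" if "v \<in> g" for v
  proof
    assume "Inl v \<in> set ys"
    then obtain zs where zs: "bcycle V E (Inl v # zs)" "set (Inl v # zs) = set ys"
      "length (Inl v # zs) = length ys"
      using bcycle_rotate_to[OF assms] by blast
    have "bpath V E (Inr g # Inl v # zs)"
      using zs(1,2) g that by (subst bpath_Cons) (auto simp: bcycle_def)
    from longest[OF this, of l] show False
      using zs(3) l pl by simp
  qed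
  have disj: "e \<inter> g = {}" if e: "Inr e \<in> set ys" for e
  proof (rule ccontr)
    assume "e \<inter> g \<noteq> {}"
    then obtain x where x: "x \<in> e" "x \<in> g" by blast
    obtain zs where zs: "bcycle V E (Inr e # zs)" "set (Inr e # zs) = set ys"
      "length (Inr e # zs) = length ys"
      using bcycle_rotate_to[OF assms e] by blast
    then have ne: "zs \<noteq> []" using l pl p_pos by auto
    have sub: "set (butlast (Inr e # zs)) \<subseteq> set ys"
      using zs(2) by (metis in_set_butlastD subsetI)
    \<comment> \<open>Dropping the last vertex of the cycle makes the path end with an edge; the new
      vertex \<open>x\<close> compensates for it.\<close>
    have "bpath V E (butlast (Inr e # zs))"
      using zs(1) bpath_take[of V E "Inr e # zs"] by (simp add: bcycle_def butlast_conv_take)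
    then have "bpath V E (Inr g # Inl x # butlast (Inr e # zs))"
      using x g avoid[OF x(2)] sub edge_subset[OF g(1)] ne
      by (auto simp: bpath_Cons)
    from longest[OF this, of l] show False
      using zs(3) l pl ne by simp
  qed
  have "\<exists>e f. e \<noteq> f \<and> Inr e \<in> set ys \<and> Inr f \<in> set ys"
  proof -
    have l2: "l \<ge> 2" using pl p_pos by simp
    define a where "a = (if isl (hd ys) then 1 else 0::nat)"
    have a: "a + 2 < length ys" using l l2 by (auto simp: a_def)
    have "\<not> isl (ys ! a)" "\<not> isl (ys ! (a + 2))"
      using bpath_isl_nth[OF yp, of a] bpath_isl_nth[OF yp, of "a + 2"] a by (auto simp: a_def)
    moreover have "ys ! a \<noteq> ys ! (a + 2)"
      using yp a by (auto simp: bpath_def nth_eq_iff_index_eq)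
    moreover have "ys ! a \<in> set ys" "ys ! (a + 2) \<in> set ys"
      using a by auto
    ultimately show ?thesis
      by (metis sum.collapse(2))
  qed
  then obtain e f where ef: "e \<noteq> f" "Inr e \<in> set ys" "Inr f \<in> set ys" by blast
  have efE: "e \<in> E" "f \<in> E"
    using ef yp by (auto simp: bpath_def)
  have "card ((e \<union> f) \<union> g) = card (e \<union> f) + card g"
    using disj[OF ef(2)] disj[OF ef(3)] efE g finite_edge
    by (intro card_Un_disjoint) auto
  moreover have "card ((e \<union> f) \<union> g) \<le> card V"
    using finite_V efE g edge_subset by (intro card_mono) auto
  ultimately show False
    using card_Un_edges[OF efE ef(1)] card_edge[OF g(1)] V_le by simp
qed

subsection \<open>Paths from an edge to a vertex\<close>

text \<open>Crossing at consecutive positions loses no entry, so the resulting cycle would have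
  \<open>p + 1\<close> vertices.\<close>

lemma no_crossing:
  assumes "bpath V E xs" "length xs = 2 * p + 2" "Suc i < length xs"
    and "incident (hd xs) (xs ! Suc i)"
  shows "\<not> incident (last xs) (xs ! i)"
proof
  assume "incident (last xs) (xs ! i)"
  then have "bcycle V E (rev (take (Suc i) xs) @ drop (Suc i) xs)"
    using bpath_crossing_bcycle[OF assms(1) _ assms(3)] assms(4) by simp
  from bcycle_length_le[OF this] show False
    using assms(2,3) by simp
qed

text \<open>Neighbours are recorded by position, so that vertices at the start and edges at the end
  become subsets of the same set \<open>{..p}\<close>; the absence of crossings then says that these
  subsets are disjoint.\<close>

abbreviation start_nbrs :: "('a + 'a set) list \<Rightarrow> nat set" where
  "start_nbrs xs \<equiv> {i. i \<le> p \<and> incident (hd xs) (xs ! (2 * i + 1))}"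

abbreviation end_nbrs :: "('a + 'a set) list \<Rightarrow> nat set" where
  "end_nbrs xs \<equiv> {i. i \<le> p \<and> incident (last xs) (xs ! (2 * i))}"

lemma nbrs_disjoint:
  assumes "bpath V E xs" "length xs = 2 * p + 2"
  shows "start_nbrs xs \<inter> end_nbrs xs = {}"
  using no_crossing[OF assms, of "2 * i" for i] assms(2) by fastforce

lemma card_start_nbrs:
  assumes "bpath V E xs" "length xs = 2 * p + 2" "hd xs = Inr g" "Inl ` g \<subseteq> set xs"
  shows "r \<le> card (start_nbrs xs)"
proof -
  have ne: "xs \<noteq> []" using assms(2) by auto
  then have "g \<in> E"
    using assms(1,3) hd_in_set[of xs] unfolding bpath_def by auto
  have "g \<subseteq> (\<lambda>i. projl (xs ! (2 * i + 1))) ` start_nbrs xs"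
  proof
    fix v assume v: "v \<in> g"
    then obtain i where i: "2 * i + 1 < length xs" "xs ! (2 * i + 1) = Inl v"
      using bpath_Inl_index[OF assms(1), of v] assms(3,4) by auto
    then have "i \<in> start_nbrs xs"
      using assms(2,3) v by auto
    then show "v \<in> (\<lambda>i. projl (xs ! (2 * i + 1))) ` start_nbrs xs"
      using i(2) by (intro image_eqI[of _ _ i]) auto
  qed
  then show ?thesis
    using surj_card_le[of "start_nbrs xs" g] card_edge[OF \<open>g \<in> E\<close>] by simp
qed

text \<open>An edge through the last vertex but off the path could be appended, giving a path with
  \<open>p + 1\<close> vertices between two edges.\<close>

lemma card_end_nbrs:
  assumes "bpath V E xs" "length xs = 2 * p + 2" "\<not> isl (hd xs)"
  shows "d < card (end_nbrs xs)"
proof -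
  obtain y where y: "y \<in> V" "last xs = Inl y"
    using bpath_nth_Inl[OF assms(1,3), of p] assms(2) last_conv_nth[of xs] by fastforce
  have "{e \<in> E. y \<in> e} \<subseteq> (\<lambda>i. projr (xs ! (2 * i))) ` end_nbrs xs"
  proof
    fix e assume e: "e \<in> {e \<in> E. y \<in> e}"
    have "Inr e \<in> set xs"
    proof (rule ccontr)
      assume "Inr e \<notin> set xs"
      then have "bpath V E (xs @ [Inr e])"
        using assms(1) e y by (auto simp: bpath_append bpath_Cons bpath_Nil)
      moreover have "hd (xs @ [Inr e]) = hd xs"
        using assms(2) by (cases xs) auto
      ultimately show False
        using longest[of "xs @ [Inr e]" "p + 1"] assms(2,3) by simp
    qed
    then obtain i where i: "2 * i < length xs" "xs ! (2 * i) = Inr e"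
      using bpath_Inr_index[OF assms(1,3)] by auto
    then have "i \<in> end_nbrs xs"
      using assms(2) y e by auto
    then show "e \<in> (\<lambda>i. projr (xs ! (2 * i))) ` end_nbrs xs"
      using i(2) by (intro image_eqI[of _ _ i]) auto
  qed
  then have "card {e \<in> E. y \<in> e} \<le> card (end_nbrs xs)"
    by (intro surj_card_le) auto
  then show ?thesis using degree_gt[OF y(1)] by simp
qed

text \<open>The equality case: the path has \<open>2 * r\<close> vertices, hence all of them, and
  the two disjoint position sets have at least \<open>r\<close> elements each inside a set of size
  \<open>2 * r\<close>.\<close>

lemma nbrs_dichotomy:
  assumes "p + 1 = 2 * r" "card V = 2 * r" "r \<le> d + 1"
    and "bpath V E xs" "\<not> isl (hd xs)" "length xs = 2 * p + 2"
  shows "Inl ` V \<subseteq> set xs" "start_nbrs xs \<union> end_nbrs xs = {..p}" "card (end_nbrs xs) = r"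
proof -
  have "card ((\<lambda>i. xs ! (2 * i + 1)) ` {..p}) = card {..p}"
    using assms(4,6) by (intro card_image inj_onI) (auto simp: bpath_def nth_eq_iff_index_eq)
  then have c: "card (Inl ` V :: ('a + 'a set) set) \<le> card ((\<lambda>i. xs ! (2 * i + 1)) ` {..p})"
    using assms(1,2) by (simp add: card_image)
  have "(\<lambda>i. xs ! (2 * i + 1)) ` {..p} \<subseteq> Inl ` V"
  proof
    fix x assume "x \<in> (\<lambda>i. xs ! (2 * i + 1)) ` {..p}"
    then obtain i where "x = xs ! (2 * i + 1)" "i \<le> p" by blast
    then show "x \<in> Inl ` V"
      using bpath_nth_Inl[OF assms(4,5), of i] assms(6) by auto
  qed
  then have "(\<lambda>i. xs ! (2 * i + 1)) ` {..p} = Inl ` V"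
    using c finite_V by (intro card_seteq) auto
  moreover have "(\<lambda>i. xs ! (2 * i + 1)) ` {..p} \<subseteq> set xs"
    using assms(6) by auto
  ultimately show sub: "Inl ` V \<subseteq> set xs" by simp
  obtain g where g: "hd xs = Inr g" using assms(5) by (cases "hd xs") auto
  have "xs \<noteq> []" using assms(6) by auto
  then have "g \<in> E" using g assms(4) hd_in_set[of xs] by (auto simp: bpath_def)
  then have rL: "r \<le> card (start_nbrs xs)"
    using card_start_nbrs[OF assms(4,6) g] sub edge_subset by blast
  have un: "card (start_nbrs xs \<union> end_nbrs xs) = card (start_nbrs xs) + card (end_nbrs xs)"
    using nbrs_disjoint[OF assms(4,6)] by (intro card_Un_disjoint) auto
  have sub': "start_nbrs xs \<union> end_nbrs xs \<subseteq> {..p}" by auto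
  from card_mono[OF _ this] have le: "card (start_nbrs xs) + card (end_nbrs xs) \<le> p + 1"
    using un by simp
  have dK: "d < card (end_nbrs xs)"
    by (rule card_end_nbrs[OF assms(4,6,5)])
  have "card {..p} \<le> card (start_nbrs xs \<union> end_nbrs xs)"
    using un rL dK assms(1,3) by simp
  then show "start_nbrs xs \<union> end_nbrs xs = {..p}"
    by (intro card_seteq[OF _ sub']) auto
  show "card (end_nbrs xs) = r"
    using le rL dK assms(1,3) by linarith
qed

text \<open>The case split is on whether the second vertex \<open>v2\<close> lies in the first edge
  \<open>f0\<close>. If so, \<open>f0\<close> and \<open>f1\<close> can be exchanged and turn out
  equal; if not, rotations force too many vertices into \<open>f1\<close>.\<close>

lemma no_spanning_edge_vertex_path:
  assumes "p + 1 = 2 * r" "card V = 2 * r" "r \<le> d + 1"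
    and "bpath V E xs" "\<not> isl (hd xs)"
  shows "length xs \<noteq> 2 * p + 2"
proof
  assume len: "length xs = 2 * p + 2"
  note D = nbrs_dichotomy[OF assms(1-3)]
  have p5: "p \<ge> 5" using assms(1) r_ge_3 by simp
  obtain a b c d' rest where "xs = a # b # c # d' # rest"
    using len p5 by (cases xs; cases "tl xs"; cases "tl (tl xs)"; cases "tl (tl (tl xs))") auto
  moreover obtain f0 where "a = Inr f0"
    using assms(5) calculation by (cases a) auto
  moreover obtain v1 where "b = Inl v1"
    using bpath_nth_Inl[OF assms(4,5), of 0] len calculation by auto
  moreover obtain f1 where "c = Inr f1"
    using bpath_nth_Inr[OF assms(4,5), of 1] len calculation by auto
  moreover obtain v2 where "d' = Inl v2"
    using bpath_nth_Inl[OF assms(4,5), of 1] len calculation by auto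
  ultimately have xs: "xs = Inr f0 # Inl v1 # Inr f1 # Inl v2 # rest" by simp
  then have f: "f0 \<in> E" "f1 \<in> E" "f0 \<noteq> f1" "v1 \<in> f0" "v1 \<in> f1" "v2 \<in> f1" "rest \<noteq> []"
    using assms(4) len p5 by (auto simp: bpath_Cons)
  have disj: "start_nbrs xs \<inter> end_nbrs xs = {}"
    using nbrs_disjoint[OF assms(4) len] .
  have L0: "0 \<in> start_nbrs xs" using xs f by simp
  show False
  proof (cases "v2 \<in> f0")
    case True
    \<comment> \<open>Exchanging \<open>f0\<close> and \<open>f1\<close> keeps the edges at the last vertex in place, so \<open>f1\<close> must have
      the same vertices as \<open>f0\<close>.\<close>
    define zs where "zs = Inr f1 # Inl v1 # Inr f0 # Inl v2 # rest"
    have z: "bpath V E zs" "\<not> isl (hd zs)" "length zs = 2 * p + 2"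
      using assms(4) len f True unfolding xs zs_def by (auto simp: bpath_Cons)
    have nth: "zs ! (2 * i + 1) = xs ! (2 * i + 1)" for i
      by (cases i; cases "i - 1") (auto simp: xs zs_def)
    have L1: "1 \<in> start_nbrs xs" using xs True p5 by simp
    have out: "\<not> incident (last xs) (Inr f0)" "\<not> incident (last xs) (Inr f1)"
    proof -
      have "0 \<notin> end_nbrs xs" "1 \<notin> end_nbrs xs" using L0 L1 disj by blast+
      then show "\<not> incident (last xs) (Inr f0)" "\<not> incident (last xs) (Inr f1)"
        using p5 by (auto simp: xs)
    qed
    have "end_nbrs zs = end_nbrs xs"
    proof -
      have "incident (last zs) (zs ! (2 * i)) = incident (last xs) (xs ! (2 * i))" for i
        using out f(7) by (cases i; cases "i - 1") (auto simp: xs zs_def)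
      then show ?thesis by simp
    qed
    then have eq: "start_nbrs zs = start_nbrs xs"
      using D(2)[OF assms(4,5) len] D(2)[OF z] disj nbrs_disjoint[OF z(1,3)] by blast
    have "v \<in> f0 \<longleftrightarrow> v \<in> f1" if v: "v \<in> V" for v
    proof -
      obtain i where i: "2 * i + 1 < length xs" "xs ! (2 * i + 1) = Inl v"
        using bpath_Inl_index[OF assms(4,5), of v] D(1)[OF assms(4,5) len] v by auto
      have "i \<in> start_nbrs xs \<longleftrightarrow> v \<in> f0"
        using i len by (simp add: xs)
      moreover have "i \<in> start_nbrs zs \<longleftrightarrow> v \<in> f1"
        using i len nth[of i] by (simp add: zs_def)
      ultimately show ?thesis using eq by blast
    qed
    then show False
      using f edge_subset by blast
  next
    case False
    have K0: "0 \<notin> end_nbrs xs" using L0 disj by blast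
    have mem: "incident (xs ! (2 * i + 1)) (Inr f1)" if i: "i \<in> end_nbrs xs" for i
    proof (cases "i \<le> 1")
      case True
      then have "i = 1" using K0 i by (cases i) auto
      then show ?thesis using f xs by simp
    next
      case False
      \<comment> \<open>Rotating the path makes \<open>xs ! ?j\<close> its last vertex, while \<open>f1\<close> is still followed by
        \<open>v2 \<notin> f0\<close>.\<close>
      let ?j = "2 * i + 1"
      define zs where "zs = take ?j xs @ rev (drop ?j xs)"
      have j: "?j < length xs" "?j > 3" using i len False by auto
      have lt: "last (take ?j xs) = xs ! (2 * i)"
        using j by (simp add: take_Suc_conv_app_nth)
      have ld: "last (drop ?j xs) = last xs" "hd (drop ?j xs) = xs ! ?j" "drop ?j xs \<noteq> []"
        using j by (auto simp: hd_drop_conv_nth)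
      have ht: "hd zs = hd xs"
        using j by (simp add: zs_def hd_append)
      have "set (take ?j xs) \<inter> set (drop ?j xs) = {}"
        using assms(4) by (intro set_take_disj_set_drop_if_distinct) (auto simp: bpath_def)
      moreover have "incident (xs ! (2 * i)) (last xs)"
        using i incident_sym[of "last xs" "xs ! (2 * i)"] by simp
      ultimately have z: "bpath V E zs"
        using assms(4) lt ld
        by (simp add: zs_def bpath_append bpath_rev bpath_take bpath_drop hd_rev)
      have zl: "length zs = 2 * p + 2" using len j by (simp add: zs_def)
      have z3: "zs ! 2 = Inr f1" "zs ! 3 = Inl v2"
        using j by (auto simp: zs_def nth_append) (auto simp: xs)
      have h: "hd zs = Inr f0" using ht xs by simp
      have "1 \<notin> start_nbrs zs"
        using z3 h \<open>v2 \<notin> f0\<close> by simp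
      moreover have "1 \<in> start_nbrs zs \<union> end_nbrs zs"
        using D(2)[OF z _ zl] h p5 by simp
      ultimately have "1 \<in> end_nbrs zs" by blast
      then have "incident (last zs) (Inr f1)" using z3 by simp
      moreover have "last zs = xs ! ?j"
        using ld by (simp add: zs_def last_append last_rev)
      ultimately show ?thesis by simp
    qed
    \<comment> \<open>Position 0 is the vertex \<open>v1\<close>, which lies in \<open>f1\<close> as
      well; together with the \<open>r\<close> positions of \<open>end_nbrs xs\<close> this gives
      \<open>r + 1\<close> vertices of \<open>f1\<close>.\<close>
    define J where "J = insert 0 (end_nbrs xs)"
    have "(\<lambda>i. projl (xs ! (2 * i + 1))) ` J \<subseteq> f1"
    proof
      fix v assume "v \<in> (\<lambda>i. projl (xs ! (2 * i + 1))) ` J"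
      then obtain i where i: "i \<in> J" "v = projl (xs ! (2 * i + 1))" by blast
      then obtain w where "xs ! (2 * i + 1) = Inl w"
        using bpath_nth_Inl[OF assms(4,5), of i] len by (auto simp: J_def)
      then show "v \<in> f1"
        using i mem[of i] f(5) by (cases "i = 0") (auto simp: J_def xs)
    qed
    moreover have "inj_on (\<lambda>i. projl (xs ! (2 * i + 1))) J"
    proof (rule inj_onI)
      fix i j assume ij: "i \<in> J" "j \<in> J" "projl (xs ! (2 * i + 1)) = projl (xs ! (2 * j + 1))"
      have b: "2 * i + 1 < length xs" "2 * j + 1 < length xs"
        using ij len by (auto simp: J_def)
      then have "xs ! (2 * i + 1) = xs ! (2 * j + 1)"
        using bpath_nth_Inl[OF assms(4,5)] ij(3) by (metis sum.sel(1))
      then show "i = j"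
        using nth_eq_iff_index_eq[of xs "2 * i + 1" "2 * j + 1"] b assms(4)
        by (simp add: bpath_def)
    qed
    ultimately have "card J \<le> card f1"
      using finite_edge[OF f(2)] card_inj_on_le by blast
    moreover have "card J = r + 1"
      using K0 D(3)[OF assms(4,5) len] by (simp add: J_def)
    ultimately show False using card_edge[OF f(2)] by simp
  qed
qed

lemma no_edge_vertex_path:
  assumes "p < k" "bpath V E xs" "length xs = 2 * p + 2" "hd xs = Inr g"
  shows "\<not> Inl ` g \<subseteq> set xs"
proof
  assume sub: "Inl ` g \<subseteq> set xs"
  have "card (start_nbrs xs \<union> end_nbrs xs) = card (start_nbrs xs) + card (end_nbrs xs)"
    using nbrs_disjoint[OF assms(2,3)] by (intro card_Un_disjoint) auto
  moreover have "card (start_nbrs xs \<union> end_nbrs xs) \<le> card {..p}"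
    by (intro card_mono) auto
  ultimately have "r + d + 1 \<le> p + 1"
    using card_start_nbrs[OF assms(2-4) sub] card_end_nbrs[OF assms(2,3)] assms(4) by simp
  \<comment> \<open>Adding \<open>k <= 2 * r\<close> and \<open>k <= 2 * d + 2\<close> gives
    \<open>k <= r + d + 1\<close>, so all inequalities are equalities.\<close>
  then have "p + 1 = 2 * r" "card V = 2 * r" "r \<le> d + 1"
    using assms(1) k_le_V V_le k_le_d by linarith+
  then show False
    using no_spanning_edge_vertex_path[OF _ _ _ assms(2)] assms(3,4) by simp
qed

subsection \<open>A cycle of length p\<close>

text \<open>If \<open>p = 1\<close>, a vertex of the first edge outside the second one has a further
  edge, and the path extends through it.\<close>

lemma p_ge_2: "p \<ge> 2"
proof (rule ccontr)
  assume "\<not> p \<ge> 2"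
  then have p1: "p = 1" using p_pos by simp
  obtain xs where xs: "bpath V E xs" "\<not> isl (hd xs)" "length xs = 2 * p + 1"
    using longest_ex by blast
  obtain f0 w f1 where x: "xs = [Inr f0, Inl w, Inr f1]"
  proof -
    obtain a b c where "xs = [a, b, c]"
      using xs(3) p1 by (auto simp: length_Suc_conv numeral_eq_Suc)
    then show ?thesis
      using that bpath_nth_Inr[OF xs(1,2), of 0] bpath_nth_Inl[OF xs(1,2), of 0]
        bpath_nth_Inr[OF xs(1,2), of 1] by auto
  qed
  then have f: "f0 \<in> E" "f1 \<in> E" "f0 \<noteq> f1" "w \<in> f0" "w \<in> f1"
    using xs(1) by (auto simp: bpath_Cons)
  have "\<not> f0 \<subseteq> f1"
    using f card_subset_eq[OF finite_edge[OF f(2)], of f0] card_edge by auto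
  then obtain y where y: "y \<in> f0" "y \<notin> f1" by blast
  then have "y \<in> V" using edge_subset[OF f(1)] by blast
  then obtain h where "h \<in> E" "y \<in> h" "h \<noteq> f0"
    using other_edge by blast
  then have "bpath V E (Inr h # Inl y # xs)"
    using xs(1) y f \<open>y \<in> V\<close> unfolding x by (auto simp: bpath_Cons)
  from longest[OF this, of 2] show False using p1 by (simp add: x)
qed

text \<open>If a longest path closes up while losing just one edge, the result is a cycle of length
  \<open>p\<close>, and the lost edge is attached to it. Without such a cycle, the first and last
  edges of every longest path satisfy the hypotheses of \<open>shifted_card_bound\<close> when
  \<open>p >= 3\<close>.\<close>

lemma bcycle_with_attached_edge:
  "\<exists>ys g v. bcycle V E ys \<and> length ys = 2 * p \<and> g \<in> E \<and> Inr g \<notin> set ys \<and> v \<in> g \<and> Inl v \<in> set ys"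
proof (rule ccontr)
  assume "\<not> ?thesis"
  then have no: False if "bcycle V E ys" "length ys = 2 * p" "g \<in> E" "Inr g \<notin> set ys" "v \<in> g"
    "Inl v \<in> set ys" for ys g v
    using that by blast
  obtain xs where xs: "bpath V E xs" "\<not> isl (hd xs)" "length xs = 2 * p + 1"
    using longest_ex by blast
  \<comment> \<open>The path is a parameter because the constraints below are also applied to
    reversed paths and to paths with exchanged edges.\<close>
  define F where "F ws i = projr (ws ! (2 * i))" for ws :: "('a + 'a set) list" and i
  define W where "W ws i = projl (ws ! (2 * i + 1))" for ws :: "('a + 'a set) list" and i
  have F: "ws ! (2 * i) = Inr (F ws i) \<and> F ws i \<in> E"
    if "bpath V E ws" "\<not> isl (hd ws)" "length ws = 2 * p + 1" "i \<le> p" for ws i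
    using bpath_nth_Inr[OF that(1,2), of i] that(3,4) by (auto simp: F_def)
  have W: "ws ! (2 * i + 1) = Inl (W ws i) \<and> W ws i \<in> V"
    if "bpath V E ws" "\<not> isl (hd ws)" "length ws = 2 * p + 1" "i < p" for ws i
    using bpath_nth_Inl[OF that(1,2), of i] that(3,4) by (auto simp: W_def)
  have hl: "hd ws = Inr (F ws 0)" "last ws = Inr (F ws p)"
    if "bpath V E ws" "\<not> isl (hd ws)" "length ws = 2 * p + 1" for ws
  proof -
    have "ws \<noteq> []" using that(3) by auto
    then show "hd ws = Inr (F ws 0)" "last ws = Inr (F ws p)"
      using F[OF that, of 0] F[OF that, of p] that(3) by (auto simp: hd_conv_nth last_conv_nth)
  qed
  \<comment> \<open>The crossing omits only the edge between the two vertices, and that edge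
    contains \<open>W ws i\<close>.\<close>
  have c1: "W ws i \<notin> F ws p"
    if ws: "bpath V E ws" "\<not> isl (hd ws)" "length ws = 2 * p + 1"
      and i: "Suc i < p" "W ws (Suc i) \<in> F ws 0" for ws i
  proof
    assume a: "W ws i \<in> F ws p"
    let ?zs = "rev (take (Suc (2 * i + 1)) ws) @ drop (2 * i + 3) ws"
    have "incident (hd ws) (ws ! (2 * i + 3))"
      using hl[OF ws] W[OF ws i(1)] i(2) by (simp add: numeral_3_eq_3)
    moreover have "incident (last ws) (ws ! (2 * i + 1))"
      using hl[OF ws] W[OF ws, of i] i(1) a by simp
    ultimately have "bcycle V E ?zs"
      using bpath_crossing_bcycle[OF ws(1), of "2 * i + 1" "2 * i + 3"] ws(3) i(1) by simp
    moreover have "length ?zs = 2 * p" using ws(3) i(1) by simp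
    moreover have "ws ! (2 * i + 2) \<notin> set ?zs"
    proof -
      have "distinct ws" using ws(1) by (simp add: bpath_def)
      then have "distinct (take (2 * i + 2) ws @ ws ! (2 * i + 2) # drop (2 * i + 3) ws)"
        using id_take_nth_drop[of "2 * i + 2" ws] ws(3) i(1) by (simp add: numeral_3_eq_3)
      then show ?thesis by simp
    qed
    moreover have "ws ! (2 * i + 2) = Inr (F ws (Suc i)) \<and> F ws (Suc i) \<in> E"
      using F[OF ws, of "Suc i"] i(1) by simp
    moreover have "W ws i \<in> F ws (Suc i)"
      using bpath_nth_incident[OF ws(1), of "2 * i + 1"] W[OF ws, of i] i(1) ws(3)
        F[OF ws, of "Suc i"] by simp
    moreover have "Inl (W ws i) \<in> set ?zs"
    proof -
      have "ws ! (2 * i + 1) \<in> set (take (Suc (2 * i + 1)) ws)"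
        using ws(3) i(1) by (subst take_Suc_conv_app_nth) auto
      then show ?thesis using W[OF ws, of i] i(1) by simp
    qed
    ultimately show False using no by metis
  qed
  have c2: "W ws (p - 1) \<notin> F ws 0" "W ws 0 \<notin> F ws p"
    if ws: "bpath V E ws" "\<not> isl (hd ws)" "length ws = 2 * p + 1" and p2: "p \<ge> 2" for ws
  proof -
    have dist: "distinct ws" and ne: "ws \<noteq> []" using ws(1,3) by (auto simp: bpath_def)
    have ap: "ws = hd ws # tl ws" "ws = butlast ws @ [last ws]" using ne by auto
    have o: "hd ws \<notin> set (tl ws)" "last ws \<notin> set (butlast ws)"
      using dist ap by (metis distinct.simps(2), metis distinct_append disjoint_insert(1) list.simps(15) inf_commute)
    have tn: "tl ws \<noteq> []" "butlast ws \<noteq> []" using ws(3) p2 by (auto simp flip: length_0_conv)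
    have Wl: "ws ! (2 * p - 1) = Inl (W ws (p - 1))"
      using W[OF ws, of "p - 1"] p2 by (cases p) auto
    have W0: "ws ! 1 = Inl (W ws 0)"
      using W[OF ws, of 0] p2 by auto
    show "W ws (p - 1) \<notin> F ws 0"
    proof
      assume a: "W ws (p - 1) \<in> F ws 0"
      have l: "last (butlast ws) = Inl (W ws (p - 1))"
        using tn Wl ws(3) p2 by (subst last_conv_nth) (auto simp: nth_butlast)
      have "bpath V E (butlast ws)"
        using ws(1) bpath_take by (simp add: butlast_conv_take)
      moreover have "hd (butlast ws) = hd ws"
        using tn ap(2) by (metis hd_append2)
      ultimately have "bcycle V E (butlast ws)"
        using tn l a hl[OF ws] by (simp add: bcycle_def)
      moreover have "incident (ws ! (2 * p - 1)) (ws ! (2 * p))"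
        using bpath_nth_incident[OF ws(1), of "2 * p - 1"] ws(3) p2 by simp
      then have "W ws (p - 1) \<in> F ws p"
        using Wl F[OF ws, of p] by simp
      ultimately show False
        using no[of "butlast ws" "F ws p" "W ws (p - 1)"] F[OF ws, of p] o(2) hl[OF ws] ws(3)
          l tn last_in_set[of "butlast ws"] by auto
    qed
    show "W ws 0 \<notin> F ws p"
    proof
      assume a: "W ws 0 \<in> F ws p"
      have h: "hd (tl ws) = Inl (W ws 0)"
        using tn W0 ws(3) p2 by (subst hd_conv_nth) (auto simp: nth_tl)
      have "bpath V E (tl ws)"
        using ws(1) bpath_drop[of V E ws 1] by (simp add: drop_Suc)
      moreover have "last (tl ws) = last ws"
        using tn by (simp add: last_tl)
      ultimately have "bcycle V E (tl ws)"
        using tn h a hl[OF ws] by (simp add: bcycle_def)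
      moreover have "incident (ws ! 0) (ws ! 1)"
        using bpath_nth_incident[OF ws(1), of 0] ws(3) p2 by simp
      then have "W ws 0 \<in> F ws 0"
        using W0 F[OF ws, of 0] by simp
      ultimately show False
        using no[of "tl ws" "F ws 0" "W ws 0"] F[OF ws, of 0] o(1) hl[OF ws] ws(3)
          h tn hd_in_set[of "tl ws"] by auto
    qed
  qed
  \<comment> \<open>A common vertex off the path would close the whole path to a cycle with
    \<open>p + 1\<close> vertices.\<close>
  have c3: "F ws 0 \<inter> F ws p \<subseteq> W ws ` {..<p}"
    if ws: "bpath V E ws" "\<not> isl (hd ws)" "length ws = 2 * p + 1" for ws
  proof
    fix x assume x: "x \<in> F ws 0 \<inter> F ws p"
    have "Inl x \<in> set ws"
    proof (rule ccontr)
      assume "Inl x \<notin> set ws"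
      moreover have "x \<in> V" using x F[OF ws, of 0] edge_subset by blast
      ultimately have "bcycle V E (Inl x # ws)"
        using ws x hl[OF ws] by (auto simp: bcycle_def bpath_Cons)
      from bcycle_length_le[OF this] show False using ws(3) by simp
    qed
    then obtain i where i: "2 * i + 1 < length ws" "ws ! (2 * i + 1) = Inl x"
      using bpath_Inl_index[OF ws(1,2)] by blast
    then have "x = W ws i" "i < p" using ws(3) by (auto simp: W_def)
    then show "x \<in> W ws ` {..<p}" by blast
  qed
  have ext: False
    if ws: "bpath V E ws" "\<not> isl (hd ws)" "length ws = 2 * p + 1"
      and y: "y \<in> F ws 0" "Inl y \<notin> set ws" "h \<in> E" "y \<in> h" "Inr h \<notin> set ws" for ws y h
  proof -
    have "y \<in> V" using y edge_subset by blast
    then have "bpath V E (Inr h # Inl y # ws)"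
      using ws y hl[OF ws] by (auto simp: bpath_Cons)
    from longest[OF this, of "p + 1"] show False using ws(3) by simp
  qed
  note Fx = F[OF xs] and Wx = W[OF xs]
  note p2 = p_ge_2
  show False
  proof (cases "p = 2")
    \<comment> \<open>Here \<open>shifted_card_bound\<close> does not apply. Instead the two end
      edges partition \<open>V\<close>, and a vertex \<open>y\<close> outside the middle edge lies
      in exactly one of them; another edge at \<open>y\<close> then extends the path.\<close>
    case True
    then obtain a b c d' e where "xs = [a, b, c, d', e]"
      using xs(3) by (auto simp: length_Suc_conv numeral_eq_Suc)
    then have x: "xs = [Inr (F xs 0), Inl (W xs 0), Inr (F xs 1), Inl (W xs 1), Inr (F xs 2)]"
      using Fx[of 0] Fx[of 1] Fx[of 2] Wx[of 0] Wx[of 1] True by simp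
    define f0 f1 f2 where "f0 = F xs 0" and "f1 = F xs 1" and "f2 = F xs 2"
    define w0 w1 where "w0 = W xs 0" and "w1 = W xs 1"
    have x': "xs = [Inr f0, Inl w0, Inr f1, Inl w1, Inr f2]"
      using x by (simp add: f0_def f1_def f2_def w0_def w1_def)
    have f: "f0 \<in> E" "f1 \<in> E" "f2 \<in> E" "f0 \<noteq> f1" "f1 \<noteq> f2" "w0 \<in> f0" "w0 \<in> f1" "w1 \<in> f1" "w1 \<in> f2"
      using xs(1) x' by (auto simp: bpath_Cons)
    have w: "w1 \<notin> f0" "w0 \<notin> f2"
      using c2[OF xs p2] True by (auto simp: w0_def w1_def f0_def f2_def)
    have disj: "f0 \<inter> f2 = {}"
    proof -
      have "f0 \<inter> f2 \<subseteq> {w0, w1}"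
        using c3[OF xs] True by (auto simp: f0_def f2_def w0_def w1_def numeral_2_eq_2 lessThan_Suc)
      then show ?thesis using w by blast
    qed
    then have cu: "card (f0 \<union> f2) = 2 * r"
      using f finite_edge card_edge by (simp add: card_Un_disjoint)
    have V: "f0 \<union> f2 = V"
      using cu V_le f edge_subset finite_V by (intro card_seteq) auto
    have "card f1 < card V"
      using V cu card_edge[OF f(2)] r_ge_3 by simp
    then have "\<not> V \<subseteq> f1"
      using card_mono[OF finite_edge[OF f(2)], of V] by auto
    then obtain y where y: "y \<in> V" "y \<notin> f1" by blast
    show False
    proof (cases "y \<in> f0")
      case True
      obtain h where "h \<in> E" "y \<in> h" "h \<noteq> f0"
        using other_edge[OF y(1)] by blast
      moreover have "y \<in> F xs 0" using True by (simp add: f0_def)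
      moreover have "Inl y \<notin> set xs" using y f by (auto simp: x')
      moreover have "Inr h \<notin> set xs" using True y disj calculation by (auto simp: x')
      ultimately show False using ext[OF xs] by blast
    next
      case False
      then have y2: "y \<in> f2" using y V by blast
      obtain h where h: "h \<in> E" "y \<in> h" "h \<noteq> f2"
        using other_edge[OF y(1)] by blast
      let ?ws = "rev xs"
      have "bpath V E ?ws" using xs(1) by (simp add: bpath_rev)
      moreover have "length ?ws = 2 * p + 1" using xs(3) by simp
      moreover have "\<not> isl (hd ?ws)" "F ?ws 0 = f2" by (simp_all add: x' F_def)
      moreover have "Inl y \<notin> set ?ws" using y f by (auto simp: x')
      moreover have "Inr h \<notin> set ?ws" using y2 y disj h by (auto simp: x')
      ultimately show False using ext[of ?ws y h] y2 h by blast
    qed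
  next
    case False
    then have p3: "p \<ge> 3" using p2 by simp
    have inj: "inj_on (W xs) {..<p}"
    proof (rule inj_onI)
      fix i j assume ij: "i \<in> {..<p}" "j \<in> {..<p}" "W xs i = W xs j"
      then have "xs ! (2 * i + 1) = xs ! (2 * j + 1)" using Wx by simp
      then show "i = j"
        using nth_eq_iff_index_eq[of xs "2 * i + 1" "2 * j + 1"] ij xs by (simp add: bpath_def)
    qed
    have WV: "W xs ` {..<p} \<subseteq> V" using Wx by blast
    \<comment> \<open>Exchanging the first two edges or the last two edges of the path keeps the vertex sequence,
      so all four combinations of end edges satisfy the same constraints. The unions of the
      exchanged edges have at least \<open>r + 1\<close> vertices each, which violates the bound.\<close>
    define Admissible where "Admissible f g \<longleftrightarrow> f \<in> E \<and> g \<in> E \<and>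
      (\<forall>i. Suc i < p \<longrightarrow> W xs (Suc i) \<in> f \<longrightarrow> W xs i \<notin> g) \<and>
      W xs (p - 1) \<notin> f \<and> W xs 0 \<notin> g \<and> f \<inter> g \<subseteq> W xs ` {..<p}" for f g
    have adm: "Admissible (F ws 0) (F ws p)"
      if ws: "bpath V E ws" "\<not> isl (hd ws)" "length ws = 2 * p + 1" "\<And>i. i < p \<Longrightarrow> W ws i = W xs i" for ws
    proof -
      have "W ws ` {..<p} = W xs ` {..<p}" using ws(4) by auto
      then show ?thesis
        using c1[OF ws(1-3)] c2[OF ws(1-3) p2] c3[OF ws(1-3)] F[OF ws(1-3), of 0]
          F[OF ws(1-3), of p] ws(4) p3 by (auto simp: Admissible_def)
    qed
    have bound: "card (f \<union> f') + card (g \<union> g') + of_bool (W xs 1 \<notin> f \<union> f') +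
        of_bool (W xs (p - 2) \<notin> g \<union> g') \<le> 2 * r + 1"
      if "Admissible f g" "Admissible f g'" "Admissible f' g" "Admissible f' g'" for f f' g g'
    proof -
      have "card (f \<union> f') + card (g \<union> g') + of_bool (W xs 1 \<notin> f \<union> f') +
        of_bool (W xs (p - 2) \<notin> g \<union> g') \<le> card V + 1"
        using that by (intro shifted_card_bound[OF finite_V inj WV p3])
          (auto simp: Admissible_def dest: edge_subset)
      then show ?thesis using V_le by simp
    qed
    have swap: "\<exists>ws. bpath V E ws \<and> \<not> isl (hd ws) \<and> length ws = 2 * p + 1 \<and>
        (\<forall>i<p. W ws i = W us i) \<and> F ws 0 = F us 1 \<and> (\<forall>i. 2 \<le> i \<longrightarrow> F ws i = F us i)"
      if us: "bpath V E us" "\<not> isl (hd us)" "length us = 2 * p + 1" and v: "W us 1 \<in> F us 0" for us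
    proof -
      obtain a b c d' rest where "us = a # b # c # d' # rest"
        using us(3) p3 by (cases us; cases "tl us"; cases "tl (tl us)"; cases "tl (tl (tl us))") auto
      then have x: "us = Inr (F us 0) # Inl (W us 0) # Inr (F us 1) # Inl (W us 1) # rest"
        using F[OF us, of 0] F[OF us, of 1] W[OF us, of 0] W[OF us, of 1] p3 by simp
      define f0 f1 w0 w1 where "f0 = F us 0" and "f1 = F us 1" and "w0 = W us 0" and "w1 = W us 1"
      have x': "us = Inr f0 # Inl w0 # Inr f1 # Inl w1 # rest"
        using x by (simp add: f0_def f1_def w0_def w1_def)
      let ?ws = "Inr f1 # Inl w0 # Inr f0 # Inl w1 # rest"
      have "bpath V E ?ws"
        using us(1) v unfolding x' by (auto simp: bpath_Cons F_def W_def)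
      moreover have "length ?ws = 2 * p + 1" using us(3) x' by simp
      moreover have "?ws ! (2 * i + 1) = us ! (2 * i + 1)" for i
        by (cases i; cases "i - 1") (auto simp: x')
      then have "W ?ws i = W us i" for i by (simp only: W_def)
      moreover have "?ws ! (2 * i) = us ! (2 * i)" if "2 \<le> i" for i
        using that by (cases i; cases "i - 1") (auto simp: x')
      then have "\<forall>i. 2 \<le> i \<longrightarrow> F ?ws i = F us i" by (simp only: F_def) simp
      moreover have "F ?ws 0 = F us 1" by (simp add: F_def x')
      ultimately show ?thesis by (intro exI[of _ ?ws]) simp
    qed
    \<comment> \<open>This is \<open>swap\<close> applied to the reversed path.\<close>
    have swap': "\<exists>ws. bpath V E ws \<and> \<not> isl (hd ws) \<and> length ws = 2 * p + 1 \<and>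
        (\<forall>i<p. W ws i = W us i) \<and> (\<forall>i. i + 2 \<le> p \<longrightarrow> F ws i = F us i) \<and> F ws p = F us (p - 1)"
      if us: "bpath V E us" "\<not> isl (hd us)" "length us = 2 * p + 1" and v: "W us (p - 2) \<in> F us p" for us
    proof -
      have Fr: "F (rev ws) i = F ws (p - i)" if "length ws = 2 * p + 1" "i \<le> p" for ws i
        using that by (simp add: F_def rev_nth diff_mult_distrib2)
      have Wr: "W (rev ws) i = W ws (p - 1 - i)" if "length ws = 2 * p + 1" "i < p" for ws i
      proof -
        have "2 * p + 1 - Suc (2 * i + 1) = 2 * (p - 1 - i) + 1" using that by simp
        then show ?thesis using that by (simp add: W_def rev_nth)
      qed
      have ne: "us \<noteq> []" using us(3) by auto
      have ru: "bpath V E (rev us)" "\<not> isl (hd (rev us))" "length (rev us) = 2 * p + 1"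
        using us hl[OF us] ne by (auto simp: bpath_rev hd_rev)
      have "W (rev us) 1 \<in> F (rev us) 0"
        using Wr[OF us(3), of 1] Fr[OF us(3), of 0] v p3 by (simp add: numeral_2_eq_2)
      from swap[OF ru this] obtain ws where ws: "bpath V E ws" "\<not> isl (hd ws)" "length ws = 2 * p + 1"
        "\<forall>i<p. W ws i = W (rev us) i" "F ws 0 = F (rev us) 1" "\<forall>i. 2 \<le> i \<longrightarrow> F ws i = F (rev us) i" by blast
      have ne': "ws \<noteq> []" using ws(3) by auto
      have "bpath V E (rev ws)" "\<not> isl (hd (rev ws))" "length (rev ws) = 2 * p + 1"
        using ws hl[OF ws(1-3)] ne' by (auto simp: bpath_rev hd_rev)
      moreover have "W (rev ws) i = W us i" if "i < p" for i
        using Wr[OF ws(3) that] ws(4) Wr[OF us(3), of "p - 1 - i"] that by simp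
      moreover have "F (rev ws) i = F us i" if "i + 2 \<le> p" for i
        using Fr[OF ws(3), of i] Fr[OF us(3), of "p - i"] ws(6) that by simp
      moreover have "F (rev ws) p = F us (p - 1)"
        using Fr[OF ws(3), of p] Fr[OF us(3), of 1] ws(5) p3 by simp
      ultimately show ?thesis by blast
    qed
    let ?f = "F xs 0" and ?f' = "F xs 1" and ?g = "F xs p" and ?g' = "F xs (p - 1)"
    have A: "Admissible ?f ?g" using adm[OF xs] by blast
    have F_ne: "F xs i \<noteq> F xs j" if "i \<le> p" "j \<le> p" "i \<noteq> j" for i j
    proof
      assume "F xs i = F xs j"
      then have "xs ! (2 * i) = xs ! (2 * j)" using Fx that by simp
      then show False
        using nth_eq_iff_index_eq[of xs "2 * i" "2 * j"] that xs by (simp add: bpath_def)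
    qed
    have cf: "card ?f = r" "card ?g = r" "r < card (?f \<union> ?f')" "r < card (?g \<union> ?g')"
      using Fx p3 card_edge card_Un_edges F_ne by auto
    have left: "Admissible ?f' ?g" if v: "W xs 1 \<in> ?f"
    proof -
      obtain ws where "bpath V E ws" "\<not> isl (hd ws)" "length ws = 2 * p + 1"
        "\<forall>i<p. W ws i = W xs i" "F ws 0 = ?f'" "\<forall>i. 2 \<le> i \<longrightarrow> F ws i = F xs i"
        using swap[OF xs v] by blast
      then show ?thesis using adm[of ws] p2 by simp
    qed
    have right: "Admissible ?f ?g'" if v: "W xs (p - 2) \<in> ?g"
    proof -
      obtain ws where "bpath V E ws" "\<not> isl (hd ws)" "length ws = 2 * p + 1"
        "\<forall>i<p. W ws i = W xs i" "\<forall>i. i + 2 \<le> p \<longrightarrow> F ws i = F xs i" "F ws p = ?g'"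
        using swap'[OF xs v] by blast
      then show ?thesis using adm[of ws] p2 by simp
    qed
    \<comment> \<open>The last two edges are exchanged first; as \<open>p >= 3\<close>, this leaves
      the edges at positions 0 and 1 in place.\<close>
    have both: "Admissible ?f' ?g'" if v: "W xs 1 \<in> ?f" "W xs (p - 2) \<in> ?g"
    proof -
      obtain ws where ws: "bpath V E ws" "\<not> isl (hd ws)" "length ws = 2 * p + 1"
        "\<forall>i<p. W ws i = W xs i" "\<forall>i. i + 2 \<le> p \<longrightarrow> F ws i = F xs i" "F ws p = ?g'"
        using swap'[OF xs v(2)] by blast
      have ws01: "F ws 0 = ?f" "F ws 1 = ?f'" "W ws 1 \<in> F ws 0"
        using ws(4,5) v(1) p3 by auto
      obtain us where us: "bpath V E us" "\<not> isl (hd us)" "length us = 2 * p + 1"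
        "\<forall>i<p. W us i = W ws i" "F us 0 = F ws 1" "\<forall>i. 2 \<le> i \<longrightarrow> F us i = F ws i"
        using swap[OF ws(1-3) ws01(3)] by blast
      then show ?thesis using adm[of us] ws ws01 p2 by simp
    qed
    \<comment> \<open>At each end, either the membership fails and an \<open>of_bool\<close> term
      adds 1, or it holds and the exchange enlarges the union by at least 1. Both ends together
      exceed \<open>2 * r + 1\<close>.\<close>
    have l: "W xs 1 \<in> ?f"
    proof (rule ccontr)
      assume n: "W xs 1 \<notin> ?f"
      then have "W xs (p - 2) \<in> ?g"
        using bound[OF A A A A] cf by (auto split: if_splits)
      then show False
        using bound[OF A right A right] cf n by (auto split: if_splits)
    qed
    have "W xs (p - 2) \<in> ?g"
    proof (rule ccontr)
      assume "W xs (p - 2) \<notin> ?g"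
      then show False
        using bound[OF A A left left] l cf by (auto split: if_splits)
    qed
    then show False
      using bound[OF A right left both] l cf by (auto split: if_splits)
  qed
qed

section \<open>Contradiction from a cycle of length \<open>p\<close> with an attached edge\<close>

lemma no_longest_edge_path: False
proof -
  obtain zs g where zs: "bcycle V E zs" "length zs = 2 * p"
    and g0: "g \<in> E" "Inr g \<notin> set zs" "\<exists>v\<in>g. Inl v \<in> set zs"
    using bcycle_with_attached_edge by blast
  obtain ys where ys: "bcycle V E ys" "\<not> isl (hd ys)" "length ys = 2 * p" and "set ys = set zs"
    using bcycle_edge_first[OF zs(1)] zs(2) by auto
  then have g: "g \<in> E" "Inr g \<notin> set ys" "\<exists>v\<in>g. Inl v \<in> set ys"
    using g0 by auto
  have yp: "bpath V E ys" using ys(1) by (simp add: bcycle_def)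
  have dist: "distinct ys" using yp by (simp add: bpath_def)
  have pk: "p < k" using no_bcycle[OF ys(1)] ys(3) by simp
  note p2 = p_ge_2
  \<comment> \<open>The cyclic order is \<open>e 0, v 0, e 1, v 1, ...\<close>, so
    \<open>v i\<close> lies in both \<open>e i\<close> and \<open>e (s i)\<close>.
    \<open>A y\<close> and \<open>I h\<close> collect the incidences of a vertex \<open>y\<close>
    and of an edge \<open>h\<close> with the cycle.\<close>
  define e where "e i = projr (ys ! (2 * i))" for i
  define v where "v i = projl (ys ! (2 * i + 1))" for i
  define s where "s i = Suc i mod p" for i
  define A where "A y = {i. i < p \<and> y \<in> e i}" for y
  define I where "I h = {i. i < p \<and> v i \<in> h}" for h
  have e: "ys ! (2 * i) = Inr (e i)" "e i \<in> E" if "i < p" for i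
    using bpath_nth_Inr[OF yp ys(2), of i] that ys(3) by (auto simp: e_def)
  have v: "ys ! (2 * i + 1) = Inl (v i)" "v i \<in> V" if "i < p" for i
    using bpath_nth_Inl[OF yp ys(2), of i] that ys(3) by (auto simp: v_def)
  have s: "s i < p" for i using p2 by (simp add: s_def)
  have v_inj: "v i = v j \<longleftrightarrow> i = j" if "i < p" "j < p" for i j
    using nth_eq_iff_index_eq[OF dist, of "2 * i + 1" "2 * j + 1"] v(1)[OF that(1)] v(1)[OF that(2)]
      that ys(3) by auto
  have v_in: "Inl (v i) \<in> set ys" if "i < p" for i
    using v(1)[OF that] that ys(3) nth_mem[of "2 * i + 1" ys] by simp
  have e_in: "Inr (e i) \<in> set ys" if "i < p" for i
    using e(1)[OF that] that ys(3) nth_mem[of "2 * i" ys] by simp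
  have v_ex: "\<exists>i<p. x = v i" if x: "Inl x \<in> set ys" for x
  proof -
    obtain i where "2 * i + 1 < length ys" "ys ! (2 * i + 1) = Inl x"
      using bpath_Inl_index[OF yp ys(2) x] by blast
    then show ?thesis using ys(3) by (intro exI[of _ i]) (simp add: v_def)
  qed
  have e_ex: "\<exists>i<p. h = e i" if h: "Inr h \<in> set ys" for h
  proof -
    obtain i where "2 * i < length ys" "ys ! (2 * i) = Inr h"
      using bpath_Inr_index[OF yp ys(2) h] by blast
    then show ?thesis using ys(3) by (intro exI[of _ i]) (simp add: e_def)
  qed
  have s_ne: "s i \<noteq> i" if "i < p" for i
    using that p2 by (cases "Suc i = p") (auto simp: s_def)
  have rot: "\<exists>zs. bcycle V E (Inl (v i) # zs) \<and> zs \<noteq> [] \<and> set (Inl (v i) # zs) = set ys \<and>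
      length zs = 2 * p - 1 \<and> hd zs = Inr (e (s i)) \<and> last zs = Inr (e i)" if i: "i < p" for i
  proof -
    define m where "m = 2 * i + 1"
    let ?r = "rotate m ys"
    have l: "m < length ys" "ys \<noteq> []" using i ys(3) by (auto simp: m_def)
    have nth: "?r ! j = ys ! ((j + m) mod (2 * p))" if "j < 2 * p" for j
      using nth_rotate[of j ys m] that ys(3) by (simp add: add.commute)
    have "?r ! 0 = Inl (v i)"
      using nth[of 0] i v(1)[OF i] by (simp add: m_def)
    moreover have "?r ! 1 = Inr (e (s i))"
    proof (cases "Suc i = p")
      case True
      then have "1 + m = 2 * p" by (simp add: m_def)
      then have "(1 + m) mod (2 * p) = 0" by simp
      moreover have "s i = 0" using True by (simp add: s_def)
      ultimately show ?thesis
        using nth[of 1] e(1)[of 0] i p2 by simp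
    next
      case False
      then have "Suc i < p" using i by simp
      moreover from this have "s i = Suc i" "(1 + m) mod (2 * p) = 2 * Suc i"
        by (simp_all add: s_def m_def)
      ultimately show ?thesis
        using nth[of 1] e(1)[of "Suc i"] p2 by simp
    qed
    moreover have "?r ! (2 * p - 1) = Inr (e i)"
    proof -
      have "2 * p - 1 + m = 2 * i + 2 * p" using i by (simp add: m_def)
      then have "(2 * p - 1 + m) mod (2 * p) = 2 * i" using i by simp
      then show ?thesis
        using nth[of "2 * p - 1"] e(1)[OF i] p2 by simp
    qed
    moreover have len: "length ?r = 2 * p" using ys(3) by simp
    moreover obtain a b zs where r: "?r = a # b # zs"
      using len p2 by (cases ?r; cases "tl ?r") auto
    moreover have "last ?r = ?r ! (2 * p - 1)"
      using l(2) len by (simp add: last_conv_nth)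
    ultimately have "?r = Inl (v i) # b # zs" "b = Inr (e (s i))" "last (b # zs) = Inr (e i)"
      "length (b # zs) = 2 * p - 1" by auto
    then show ?thesis
      using bcycle_rotate[OF ys(1), of m] set_rotate[of m ys]
      by (intro exI[of _ "b # zs"]) auto
  qed
  have card_I: "card h \<le> card {y \<in> h. Inl y \<notin> set ys} + card (I h)" if "h \<in> E" for h
  proof -
    have "h \<subseteq> {y \<in> h. Inl y \<notin> set ys} \<union> v ` I h"
      using v_ex by (auto simp: I_def)
    then have "card h \<le> card ({y \<in> h. Inl y \<notin> set ys} \<union> v ` I h)"
      using finite_edge[OF that] by (intro card_mono) (auto simp: I_def)
    also have "\<dots> \<le> card {y \<in> h. Inl y \<notin> set ys} + card (v ` I h)"
      by (rule card_Un_le)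
    also have "card (v ` I h) \<le> card (I h)"
      by (intro card_image_le) (auto simp: I_def)
    finally show ?thesis by simp
  qed
  have e_sub_A: "card {h \<in> E. y \<in> h} \<le> card (A y) + card (H - e ` A y)"
    if "{h \<in> E. y \<in> h} \<subseteq> e ` A y \<union> H" "finite H" for y H
  proof -
    have "{h \<in> E. y \<in> h} \<subseteq> e ` A y \<union> (H - e ` A y)" using that(1) by blast
    then have "card {h \<in> E. y \<in> h} \<le> card (e ` A y \<union> (H - e ` A y))"
      using that(2) by (intro card_mono) (auto simp: A_def)
    also have "\<dots> \<le> card (e ` A y) + card (H - e ` A y)" by (rule card_Un_le)
    also have "card (e ` A y) \<le> card (A y)" by (intro card_image_le) (auto simp: A_def)
    finally show ?thesis by simp
  qed
  show False
  \<comment> \<open>The split is on whether some edge off the cycle has vertices both on and off it.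
    If none has, the attached edge \<open>g\<close> lies entirely on the cycle.\<close>
  proof (cases "\<exists>h\<in>E. Inr h \<notin> set ys \<and> (\<exists>w\<in>h. Inl w \<in> set ys) \<and> (\<exists>w\<in>h. Inl w \<notin> set ys)")
    case True
    then obtain h w y0 where h: "h \<in> E" "Inr h \<notin> set ys" "w \<in> h" "Inl w \<in> set ys"
      "y0 \<in> h" "Inl y0 \<notin> set ys" by blast
    define Y where "Y = {y \<in> h. Inl y \<notin> set ys}"
    have Y: "y \<in> V" "y \<in> h" "Inl y \<notin> set ys" if "y \<in> Y" for y
      using that edge_subset[OF h(1)] by (auto simp: Y_def)
    have finY: "finite Y" using finite_edge[OF h(1)] by (simp add: Y_def)
    obtain i0 where i0: "i0 < p" "w = v i0" using v_ex[OF h(4)] by blast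
    \<comment> \<open>A second edge \<open>f\<close> off the cycle at \<open>y\<close> would give
      the path \<open>f, y, h, w\<close> continued around the cycle, with \<open>p + 1\<close>
      vertices. So at most the edge \<open>h\<close> is missing from the degree of
      \<open>y\<close>.\<close>
    have d_le: "d \<le> card (A y)" if y: "y \<in> Y" for y
    proof -
      have "{f \<in> E. y \<in> f} \<subseteq> e ` A y \<union> {h}"
      proof
        fix f assume f: "f \<in> {f \<in> E. y \<in> f}"
        show "f \<in> e ` A y \<union> {h}"
        proof (cases "f = h")
          case False
          have "Inr f \<in> set ys"
          proof (rule ccontr)
            assume nf: "Inr f \<notin> set ys"
            obtain zs where zs: "bcycle V E (Inl w # zs)" "set (Inl w # zs) = set ys"
              "length (Inl w # zs) = length ys"
              using bcycle_rotate_to[OF ys(1) h(4)] by blast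
            have "bpath V E (Inr f # Inl y # Inr h # Inl w # zs)"
              using zs(1) nf f False h Y[OF y] zs(2)[symmetric]
              by (auto simp: bpath_Cons bcycle_def)
            from longest[OF this, of "p + 1"] show False using zs(3) ys(3) by simp
          qed
          then show ?thesis using e_ex f by (auto simp: A_def)
        qed simp
      qed
      from e_sub_A[OF this] have "card {f \<in> E. y \<in> f} \<le> card (A y) + card ({h} - e ` A y)"
        by simp
      moreover have "card ({h} - e ` A y) \<le> 1"
        using card_mono[of "{h}" "{h} - e ` A y"] by auto
      ultimately show ?thesis using degree_gt[OF Y(1)[OF y]] by simp
    qed
    show False
    proof (cases "card Y = 1")
      case True
      then obtain y where y: "Y = {y}" by (auto simp: card_1_singleton_iff)
      then have yY: "y \<in> Y" by simp
      have "A y \<noteq> {}" using d_le[OF yY] d_pos by auto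
      then obtain j where j: "j < p" "y \<in> e j" by (auto simp: A_def)
      obtain zs where zs: "bcycle V E (Inr (e j) # zs)" "set (Inr (e j) # zs) = set ys"
        "length (Inr (e j) # zs) = length ys"
        using bcycle_rotate_to[OF ys(1) e_in[OF j(1)]] by blast
      \<comment> \<open>The cycle is cut before \<open>e j\<close>, so this path ends with a vertex
        and contains \<open>y\<close> and all cycle vertices, hence all of \<open>h\<close>.\<close>
      have "bpath V E (Inr h # Inl y # Inr (e j) # zs)"
        using zs(1) h j Y[OF yY] zs(2)[symmetric] by (auto simp: bpath_Cons bcycle_def)
      moreover have "Inl ` h \<subseteq> set (Inr h # Inl y # Inr (e j) # zs)"
      proof -
        have "Inl x \<in> set ys" if "x \<in> h" "x \<noteq> y" for x
          using that y by (auto simp: Y_def)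
        then show ?thesis using zs(2) by auto
      qed
      ultimately show False
        using no_edge_vertex_path[OF pk, of "Inr h # Inl y # Inr (e j) # zs" h] zs(3) ys(3) by simp
    next
      case False
      \<comment> \<open>At each vertex of the cycle, the two vertices \<open>y\<close>, \<open>y'\<close> outside have together at most two
        incidences with the two cycle edges there, and none if that vertex is in \<open>h\<close>.\<close>
      have S1: "y \<notin> e i \<and> y \<notin> e (s i)" if y: "y \<in> Y" and i: "i \<in> I h" for y i
      proof -
        have ip: "i < p" "v i \<in> h" using i by (auto simp: I_def)
        obtain zs where zs: "bcycle V E (Inl (v i) # zs)" "zs \<noteq> []" "set (Inl (v i) # zs) = set ys"
          "length zs = 2 * p - 1" "hd zs = Inr (e (s i))" "last zs = Inr (e i)"
          using rot[OF ip(1)] by blast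
        have False if "y \<in> e i"
        proof -
          have "bcycle V E (Inl y # Inr h # Inl (v i) # zs)"
            using zs(1,2,6) h(1,2) ip Y[OF y] that zs(3)[symmetric]
            by (auto simp: bpath_Cons bcycle_def)
          from bcycle_length_le[OF this] show False using zs(4) p2 by simp
        qed
        moreover have False if "y \<in> e (s i)"
        proof -
          have "bcycle V E (Inl (v i) # Inr h # Inl y # zs)"
            using zs(1,2,5,6) h(1,2) ip Y[OF y] that zs(3)[symmetric]
            by (auto simp: bpath_Cons bcycle_def)
          from bcycle_length_le[OF this] show False using zs(4) p2 by simp
        qed
        ultimately show ?thesis by blast
      qed
      \<comment> \<open>While \<open>S1\<close> inserts \<open>h\<close> and \<open>y\<close> next
        to \<open>v i\<close>, here \<open>v i\<close> is replaced by \<open>y, h, y'\<close>.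
        Either way the cycle grows to \<open>p + 1\<close> vertices.\<close>
      have S2: "y' \<notin> e (s i)" if y: "y \<in> Y" "y' \<in> Y" "y \<noteq> y'" and i: "i < p" "y \<in> e i" for y y' i
      proof
        assume y': "y' \<in> e (s i)"
        obtain zs where zs: "bcycle V E (Inl (v i) # zs)" "zs \<noteq> []" "set (Inl (v i) # zs) = set ys"
          "length zs = 2 * p - 1" "hd zs = Inr (e (s i))" "last zs = Inr (e i)"
          using rot[OF i(1)] by blast
        have "bcycle V E (Inl y # Inr h # Inl y' # zs)"
          using zs(1,2,5,6) h(1,2) i y(3) Y[OF y(1)] Y[OF y(2)] y' zs(3)[symmetric]
          by (auto simp: bpath_Cons bcycle_def)
        from bcycle_length_le[OF this] show False using zs(4) p2 by simp
      qed
      have sum_s: "(\<Sum>i<p. of_bool (y \<in> e (s i))) = card (A y)" for y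
      proof -
        have "inj_on s {..<p}"
          unfolding s_def by (rule inj_onI) (auto simp: mod_Suc split: if_splits)
        moreover have "s ` {..<p} = {..<p}"
          using calculation s by (intro endo_inj_surj) auto
        ultimately have "bij_betw s {..<p} {..<p}" by (simp add: bij_betw_def)
        then have "(\<Sum>i<p. of_bool (y \<in> e (s i))) = (\<Sum>i<p. of_bool (y \<in> e i) :: nat)"
          by (rule sum.reindex_bij_betw)
        also have "\<dots> = card (A y)"
          by (simp add: A_def sum.If_cases of_bool_def Int_def)
        finally show ?thesis .
      qed
      have sum_e: "(\<Sum>i<p. of_bool (y \<in> e i)) = card (A y)" for y
        by (simp add: A_def sum.If_cases of_bool_def Int_def)
      have sum_I: "(\<Sum>i<p. 2 * of_bool (i \<notin> I h)) + 2 * card (I h) = 2 * p"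
      proof -
        have "(\<Sum>i<p. 2 * of_bool (i \<notin> I h)) + (\<Sum>i<p. 2 * of_bool (i \<in> I h)) = (\<Sum>i<p. 2 :: nat)"
          by (subst sum.distrib[symmetric]) (intro sum.cong, auto)
        moreover have "(\<Sum>i<p. of_bool (i \<in> I h)) = card (I h)"
        proof -
          have "{i. i < p \<and> i \<in> I h} = I h" by (auto simp: I_def)
          then show ?thesis by (simp add: sum.If_cases of_bool_def Int_def)
        qed
        ultimately show ?thesis by (simp flip: sum_distrib_left)
      qed
      \<comment> \<open>Each cycle edge is seen from both of its neighbouring cycle vertices, hence
        the factors 2. The function \<open>c\<close> records incidences known to be missing.\<close>
      have count: "2 * card (A y) + 2 * card (A y') + (\<Sum>i<p. c i) + 2 * card (I h) \<le> 2 * p"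
        if c: "\<And>i. i < p \<Longrightarrow> of_bool (y \<in> e i) + of_bool (y \<in> e (s i)) + of_bool (y' \<in> e i) +
            of_bool (y' \<in> e (s i)) + c i \<le> (2::nat) * of_bool (i \<notin> I h)" for y y' c
      proof -
        have "(\<Sum>i<p. of_bool (y \<in> e i) + of_bool (y \<in> e (s i)) + of_bool (y' \<in> e i) +
            of_bool (y' \<in> e (s i)) + c i) \<le> (\<Sum>i<p. 2 * of_bool (i \<notin> I h))"
          using c by (intro sum_mono) simp
        then show ?thesis
          using sum_I by (simp only: sum.distrib sum_e sum_s)
      qed
      have local: "of_bool (y \<in> e i) + of_bool (y \<in> e (s i)) + of_bool (y' \<in> e i) +
            of_bool (y' \<in> e (s i)) \<le> (2::nat) * of_bool (i \<notin> I h)"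
        if y: "y \<in> Y" "y' \<in> Y" "y \<noteq> y'" and i: "i < p" for y y' i
        using S1[OF y(1), of i] S1[OF y(2), of i] S2[OF y i] S2[OF y(2,1) y(3)[symmetric] i]
        by (cases "i \<in> I h") auto
      have i0I: "i0 \<in> I h" using i0 h(3) by (simp add: I_def)
      have finI: "finite (I h)" by (simp add: I_def)
      have cY: "card Y \<ge> 2"
      proof -
        have "Y \<noteq> {}" using h(5,6) by (auto simp: Y_def)
        then have "card Y \<noteq> 0" using finY by simp
        then show ?thesis using False by linarith
      qed
      have two_d: "2 * d + 1 \<ge> p" using k_le_d pk by simp
      have cI0: "card (I h) \<ge> 1"
        using i0I finI by (metis One_nat_def Suc_leI card_gt_0_iff empty_iff)
      show False
      proof (cases "card (I h) = 1")
        case False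
        obtain y y' where y: "y \<in> Y" "y' \<in> Y" "y \<noteq> y'"
          using cY by (metis card_le_Suc0_iff_eq finY not_less_eq_eq numeral_2_eq_2)
        have "2 * card (A y) + 2 * card (A y') + (\<Sum>i<p. 0) + 2 * card (I h) \<le> 2 * p"
          using local[OF y] by (intro count) simp
        then show False
          using d_le[OF y(1)] d_le[OF y(2)] two_d cI0 False by simp
      next
        case True
        then have I: "I h = {i0}" using i0I by (auto simp: card_1_singleton_iff)
        \<comment> \<open>Now the count is short by exactly one incidence, as
          \<open>p <= 2 * d + 1\<close>. It is found at the next cycle vertex \<open>v i1\<close>:
          its edge \<open>e i1\<close> also contains \<open>v i0\<close> and avoids
          \<open>Y\<close>, and its other edge cannot contain all of \<open>Y\<close>, since with
          two cycle vertices and at least \<open>r - 1\<close> vertices of \<open>Y\<close> it would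
          be too large.\<close>
        define i1 where "i1 = s i0"
        let ?e = "e (s i1)"
        have i1: "i1 < p" "i1 \<noteq> i0" "s i1 < p" "s i1 \<noteq> i1"
          using s s_ne[OF i0(1)] s_ne[of i1] by (auto simp: i1_def)
        have v12: "v i1 \<in> ?e" "v (s i1) \<in> ?e"
        proof -
          obtain zs where zs: "bcycle V E (Inl (v i1) # zs)" "zs \<noteq> []" "hd zs = Inr ?e"
            using rot[OF i1(1)] by blast
          then show "v i1 \<in> ?e" by (auto simp: bcycle_def bpath_Cons)
          have "incident (ys ! (2 * s i1)) (ys ! (2 * s i1 + 1))"
            using bpath_nth_incident[OF yp, of "2 * s i1"] i1(3) ys(3) by simp
          then show "v (s i1) \<in> ?e" using e(1)[OF i1(3)] v(1)[OF i1(3)] by simp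
        qed
        have "\<not> Y \<subseteq> ?e"
        proof
          assume sub: "Y \<subseteq> ?e"
          have out: "v i1 \<notin> Y" "v (s i1) \<notin> Y" using v_in i1 by (auto simp: Y_def)
          have "card (insert (v i1) (insert (v (s i1)) Y)) = card Y + 2"
            using out finY v_inj[OF i1(1,3)] i1(4) by auto
          moreover have "card (insert (v i1) (insert (v (s i1)) Y)) \<le> card ?e"
            using sub v12 finite_edge[OF e(2)[OF i1(3)]] by (intro card_mono) auto
          ultimately show False
            using card_edge[OF e(2)[OF i1(3)]] card_I[OF h(1)] card_edge[OF h(1)] True
            by (simp add: Y_def)
        qed
        then obtain y where y: "y \<in> Y" "y \<notin> ?e" by blast
        obtain y' where y': "y' \<in> Y" "y \<noteq> y'"
          using cY y(1) by (metis card_le_Suc0_iff_eq finY not_less_eq_eq numeral_2_eq_2)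
        have z: "y \<notin> e i1" "y' \<notin> e i1"
          using S1[OF y(1) i0I] S1[OF y'(1) i0I] by (auto simp: i1_def)
        have "2 * card (A y) + 2 * card (A y') + (\<Sum>i<p. of_bool (i = i1)) + 2 * card (I h) \<le> 2 * p"
        proof (rule count)
          fix i assume i: "i < p"
          show "of_bool (y \<in> e i) + of_bool (y \<in> e (s i)) + of_bool (y' \<in> e i) +
            of_bool (y' \<in> e (s i)) + of_bool (i = i1) \<le> (2::nat) * of_bool (i \<notin> I h)"
          proof (cases "i = i1")
            case True
            then show ?thesis using z y(2) i1(2) I by simp
          next
            case False
            then show ?thesis using local[OF y(1) y' i] by simp
          qed
        qed
        moreover have "(\<Sum>i<p. of_bool (i = i1)) = (1::nat)"
          using i1(1) by (simp add: of_bool_def)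
        ultimately show False
          using d_le[OF y(1)] d_le[OF y'(1)] two_d True by simp
      qed
    qed
  next
    case False
    have g_in: "Inl x \<in> set ys" if "x \<in> g" for x
      using False g that by blast
    obtain y where y: "y \<in> V" "Inl y \<notin> set ys"
    proof -
      have "\<not> V \<subseteq> v ` {..<p}"
      proof
        assume "V \<subseteq> v ` {..<p}"
        then have "card V \<le> p" using surj_card_le[of "{..<p}" V v] by simp
        then show False using pk k_le_V by simp
      qed
      then show ?thesis using that v_ex by blast
    qed
    have "{f \<in> E. y \<in> f} \<subseteq> e ` A y \<union> {}"
    proof
      fix f assume f: "f \<in> {f \<in> E. y \<in> f}"
      have "Inr f \<in> set ys"
      proof (rule ccontr)
        assume nf: "Inr f \<notin> set ys"
        \<comment> \<open>An edge \<open>f\<close> off the cycle at \<open>y\<close> misses the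
          cycle vertices, so \<open>f\<close> and \<open>g\<close> partition \<open>V\<close>. Then
          \<open>e 0\<close> meets \<open>f\<close> in some \<open>x\<close>, and the cycle vertex
          \<open>w\<close> before \<open>e 0\<close> is in \<open>g\<close>: the path
          \<open>f, x, e 0, ..., w, g\<close> is too long.\<close>
        have fout: "Inl x \<notin> set ys" if "x \<in> f" for x
          using False nf f y that by blast
        then have disj: "g \<inter> f = {}" using g_in by blast
        have "card (g \<union> f) = 2 * r"
          using disj f g finite_edge card_edge by (simp add: card_Un_disjoint)
        then have gf: "g \<union> f = V"
          using V_le f g(1) edge_subset finite_V by (intro card_seteq) auto
        have "e 0 \<noteq> g" using e_in[of 0] g(2) p2 by auto
        moreover have e0: "e 0 \<in> E" using e(2)[of 0] p2 by simp
        ultimately have "\<not> e 0 \<subseteq> g"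
          using card_subset_eq[OF finite_edge[OF g(1)], of "e 0"] card_edge g(1) by auto
        then obtain x where x: "x \<in> e 0" "x \<in> f" using gf edge_subset[OF e0] by blast
        then have xV: "x \<in> V" using gf by blast
        obtain zs where zs: "bcycle V E (Inr (e 0) # zs)" "set (Inr (e 0) # zs) = set ys"
          "length (Inr (e 0) # zs) = length ys"
          using bcycle_rotate_to[OF ys(1) e_in[of 0]] p2 by auto
        have zne: "zs \<noteq> []" using zs(3) ys(3) p2 by auto
        have "incident (last zs) (Inr (e 0))" using zs(1) zne by (simp add: bcycle_def)
        then obtain w where w: "last zs = Inl w" by (cases "last zs") auto
        have "Inl w \<in> set ys" using w zne zs(2) last_in_set[of zs] by auto
        then have "w \<in> V" "w \<notin> f" using fout yp by (auto simp: bpath_def)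
        then have wg: "w \<in> g" using gf by blast
        have fg: "f \<noteq> g" using x disj by blast
        have "bpath V E ((Inr (e 0) # zs) @ [Inr g])"
          using zs(1) zs(2)[symmetric] g(1,2) wg w zne
          by (auto simp: bcycle_def bpath_append bpath_Cons bpath_Nil)
        then have "bpath V E (Inr f # Inl x # (Inr (e 0) # zs) @ [Inr g])"
          using nf f fg fout[OF x(2)] x xV zs(2)[symmetric] by (auto simp: bpath_Cons)
        from longest[OF this, of "p + 1"] show False using zs(3) ys(3) by simp
      qed
      then show "f \<in> e ` A y \<union> {}" using e_ex f by (auto simp: A_def)
    qed
    from e_sub_A[OF this] have dA: "d < card (A y)" using degree_gt[OF y(1)] by simp
    have "{x \<in> g. Inl x \<notin> set ys} = {}" using g_in by blast
    then have "card {x \<in> g. Inl x \<notin> set ys} = 0" by (simp only: card.empty)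
    then have rI: "r \<le> card (I g)" using card_I[OF g(1)] card_edge[OF g(1)] by linarith
    \<comment> \<open>Disjointness would give \<open>r + d + 1 <= p < k\<close>, but
      \<open>k <= r + d + 1\<close>. A common index allows the cycle to be cut at \<open>v i\<close>
      into a path from \<open>g\<close> to \<open>y\<close> through every cycle vertex.\<close>
    have "A y \<inter> I g \<noteq> {}"
    proof
      assume "A y \<inter> I g = {}"
      then have "card (A y \<union> I g) = card (A y) + card (I g)"
        by (intro card_Un_disjoint) (auto simp: A_def I_def)
      moreover have "card (A y \<union> I g) \<le> card {..<p}"
        by (intro card_mono) (auto simp: A_def I_def)
      ultimately show False
        using dA rI pk k_le_V V_le k_le_d by simp
    qed
    then obtain i where i: "i < p" "y \<in> e i" "v i \<in> g" by (auto simp: A_def I_def)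
    obtain zs where zs: "bcycle V E (Inl (v i) # zs)" "zs \<noteq> []" "set (Inl (v i) # zs) = set ys"
      "length zs = 2 * p - 1" "last zs = Inr (e i)"
      using rot[OF i(1)] by blast
    let ?xs = "Inr g # (Inl (v i) # zs) @ [Inl y]"
    have "bpath V E ((Inl (v i) # zs) @ [Inl y])"
      using zs(1,2,5) zs(3)[symmetric] y i by (auto simp: bcycle_def bpath_append bpath_Cons bpath_Nil)
    moreover have "Inr g \<notin> set ((Inl (v i) # zs) @ [Inl y])"
      using zs(3) g(2) by auto
    ultimately have "bpath V E ?xs"
      using g(1) i(3) by (subst bpath_Cons) auto
    moreover have "length ?xs = 2 * p + 2" using zs(4) p2 by simp
    moreover have "Inl ` g \<subseteq> set ?xs" using g_in zs(3) by auto
    ultimately show False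
      using no_edge_vertex_path[OF pk, of ?xs g] by simp
  qed
qed

end

section \<open>Existence of a longest path, and derivation of the numerical conditions\<close>

lemma (in no_long_bcycle) inconsistent: False
proof -
  define Q where "Q q \<longleftrightarrow> (\<exists>xs. bpath V E xs \<and> \<not> isl (hd xs) \<and> length xs = 2 * q + 1)" for q
  have "card E \<noteq> 0" using k_le_E r_le_k r_ge_3 by simp
  then obtain e where "e \<in> E" by fastforce
  then have "bpath V E [Inr e]" by (simp add: bpath_Cons bpath_Nil)
  then have Q0: "Q 0" by (force simp: Q_def)
  have bound: "q \<le> card (Inl ` V \<union> Inr ` E)" if "Q q" for q
  proof -
    obtain xs where xs: "bpath V E xs" "length xs = 2 * q + 1"
      using \<open>Q q\<close> by (auto simp: Q_def)
    then have "card (set xs) = 2 * q + 1" by (simp add: bpath_def distinct_card)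
    moreover have "card (set xs) \<le> card (Inl ` V \<union> Inr ` E)"
      using xs(1) finite_V finite_E by (intro card_mono) (auto simp: bpath_def)
    ultimately show ?thesis by simp
  qed
  define p where "p = (GREATEST q. Q q)"
  have "Q p" unfolding p_def using Q0 bound by (rule GreatestI_nat)
  moreover have "q \<le> p" if "Q q" for q
    unfolding p_def using that bound by (rule Greatest_le_nat)
  ultimately interpret longest_edge_path V E r k d p
    by unfold_locales (simp add: Q_def, auto simp: Q_def)
  show False by (rule no_longest_edge_path)
qed

lemma sum_degree:
  assumes "finite V" "E \<subseteq> Pow V" "uniform r E"
  shows "(\<Sum>v\<in>V. degree E v) = r * card E"
proof -
  have finE: "finite E" using assms(1,2) finite_subset by blast
  have "(\<Sum>v\<in>V. degree E v) = (\<Sum>v\<in>V. \<Sum>e\<in>E. of_bool (v \<in> e))"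
    using finE by (simp add: degree_def sum.If_cases of_bool_def Int_def)
  also have "\<dots> = (\<Sum>e\<in>E. \<Sum>v\<in>V. of_bool (v \<in> e))"
    by (rule sum.swap)
  also have "\<dots> = (\<Sum>e\<in>E. card e)"
  proof (rule sum.cong)
    fix e assume "e \<in> E"
    then have "{v. v \<in> V \<and> v \<in> e} = e" using assms(2) by auto
    then show "(\<Sum>v\<in>V. of_bool (v \<in> e)) = card e"
      using assms(1) by (simp add: sum.If_cases of_bool_def Int_def)
  qed simp
  also have "\<dots> = r * card E"
    using assms(3) by (simp add: uniform_def)
  finally show ?thesis .
qed

theorem theorem1p8:
  fixes V :: "'a set" and E :: "'a set set" and n k r t :: nat
  assumes "n \<ge> k" and "k \<ge> r" and "r \<ge> 3"
    and "t = (n - 1) div 2" and "r > t"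
    and "hypergraph V E" and "card V = n" and "uniform r E"
    and "min_degree V E \<ge> (r * (k - 1)) div n + 1"
  shows "\<exists>vs es. berge_cycle V E vs es \<and> length es \<ge> k"
proof (rule ccontr)
  assume none: "\<not> ?thesis"
  define d where "d = (r * (k - 1)) div n"
  have V: "finite V" "E \<subseteq> Pow V" using assms(6) by (auto simp: hypergraph_def)
  have n0: "n > 0" and n2r: "n \<le> 2 * r" using assms(1-5) by auto
  have deg: "d < degree E v" if "v \<in> V" for v
  proof -
    have "min_degree V E \<le> degree E v"
      using that V(1) by (simp add: min_degree_def)
    then show ?thesis using assms(9) by (simp add: d_def)
  qed
  \<comment> \<open>Since \<open>n <= 2 * r\<close>, the quotient \<open>r * (k - 1) / n\<close> is
    at least \<open>(k - 1) / 2\<close>; rounding down costs at most one in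
    \<open>k\<close>.\<close>
  have kd: "k \<le> 2 * d + 2"
  proof -
    have "(k - 1) div 2 * n \<le> (k - 1) div 2 * (2 * r)"
      using n2r by (intro mult_le_mono) auto
    also have "\<dots> = r * ((k - 1) div 2 * 2)" by simp
    also have "\<dots> \<le> r * (k - 1)" by (intro mult_le_mono) auto
    finally have "(k - 1) div 2 \<le> d"
      using n0 by (simp add: d_def less_eq_div_iff_mult_less_eq)
    then show ?thesis by linarith
  qed
  \<comment> \<open>Double counting of incidences: the degree sum \<open>r * card E\<close> exceeds
    \<open>r * (k - 1)\<close>.\<close>
  have kE: "k \<le> card E"
  proof -
    have "r * (k - 1) < n * (d + 1)"
      using n0 by (simp add: d_def dividend_less_times_div)
    also have "\<dots> \<le> (\<Sum>v\<in>V. degree E v)"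
      using sum_bounded_below[of V "d + 1" "degree E"] deg assms(7) by (simp add: Suc_leI)
    also have "\<dots> = r * card E"
      by (rule sum_degree[OF V assms(8)])
    finally have "k - 1 < card E" by simp
    then show ?thesis by linarith
  qed
  interpret no_long_bcycle V E r k d
  proof
    show "length ys < 2 * k" if y: "bcycle V E ys" for ys
    proof (rule ccontr)
      assume "\<not> length ys < 2 * k"
      then have "k \<le> length ys div 2" by linarith
      then show False using bcycle_berge_cycle[OF y] none by metis
    qed
  qed (use V n2r assms kd kE deg in \<open>auto simp: uniform_def degree_def\<close>)
  show False by (rule inconsistent)
qed

end
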